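(* Let $M$ be a convex subset of a finite-dimensional (real) Banach space, equipped with the metric induced by the norm and with a chosen base point $0\in M$. Then $\mathrm{Lip}_0(M)$ has a strongly unique predual.
   Context: For a metric space $(M,d)$ with a distinguished base point $0\in M$, $\mathrm{Lip}_0(M)$ is the Banach space of all Lipschitz functions $f:M\to\mathbb{R}$ with $f(0)=0$, with norm $\|f\|_L=\sup\{\frac{f(x)-f(y)}{d(x,y)} : x\neq y\in M\}$ (the base point is any point of $M$, not necessarily the origin of the ambient space). For a Banach space $X$, a closed subspace $Y\subset X^*$ is called a predual of $X$ if the mapping $T:X\to Y^*$ given by $\langle Tx,y\rangle=\langle y,x\rangle$ for $x\in X$, $y\in Y$ is a surjective linear isometry. $X$ has a strongly unique predual if there is exactly one closed subspace $Y\subset X^*$ that is a predual of $X$ (equivalently, $X$ is a dual Banach space and every linear isometry from $X$ onto a dual Banach space $Z^*$ is weak$^*$-to-weak$^*$ continuous). *)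

theory Defs
  imports "HOL-Analysis.Analysis" "HOL-Library.Function_Algebras"
begin

instantiation "fun" :: (type, real_vector) real_vector
begin

definition scaleR_fun :: "real \<Rightarrow> ('a \<Rightarrow> 'b) \<Rightarrow> 'a \<Rightarrow> 'b"
  where "scaleR_fun c f = (\<lambda>x. c *\<^sub>R f x)"

instance
  by standard (auto simp: scaleR_fun_def fun_eq_iff scaleR_add_right scaleR_add_left)

end

text \<open>
  The space of Lipschitz functions on \<open>M\<close> depends on the set \<open>M\<close>, so it cannot be a type.
  A normed space is therefore given by a carrier \<open>X\<close>, a linear subspace of some real vector
  space, together with a norm \<open>N\<close> that is only relevant on \<open>X\<close>.
  Functions with domain a carrier are represented by total functions vanishing outside of it,
  which makes equality of such functions agree with equality on the carrier.
\<close>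

definition linear_on_carrier :: "'v::real_vector set \<Rightarrow> ('v \<Rightarrow> 'w::real_vector) \<Rightarrow> bool"
  where "linear_on_carrier X T \<longleftrightarrow>
    (\<forall>x\<in>X. \<forall>y\<in>X. T (x + y) = T x + T y) \<and> (\<forall>c. \<forall>x\<in>X. T (c *\<^sub>R x) = c *\<^sub>R T x)"

definition dual_space :: "'v::real_vector set \<Rightarrow> ('v \<Rightarrow> real) \<Rightarrow> ('v \<Rightarrow> real) set"
  where "dual_space X N = {\<phi>. linear_on_carrier X \<phi> \<and>
    (\<exists>C. \<forall>x\<in>X. \<bar>\<phi> x\<bar> \<le> C * N x) \<and> (\<forall>x. x \<notin> X \<longrightarrow> \<phi> x = 0)}"

definition dual_norm :: "'v::real_vector set \<Rightarrow> ('v \<Rightarrow> real) \<Rightarrow> ('v \<Rightarrow> real) \<Rightarrow> real"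
  where "dual_norm X N \<phi> = Sup {\<bar>\<phi> x\<bar> | x. x \<in> X \<and> N x \<le> 1}"

definition closed_subspace_of :: "'v::real_vector set \<Rightarrow> ('v \<Rightarrow> real) \<Rightarrow> 'v set \<Rightarrow> bool"
  where "closed_subspace_of X N Y \<longleftrightarrow> Y \<subseteq> X \<and> subspace Y \<and>
    (\<forall>x\<in>X - Y. \<exists>\<epsilon>>0. \<forall>z\<in>X. N (z - x) < \<epsilon> \<longrightarrow> z \<notin> Y)"

definition evaluation :: "('v \<Rightarrow> real) set \<Rightarrow> 'v \<Rightarrow> ('v \<Rightarrow> real) \<Rightarrow> real"
  where "evaluation Y x = (\<lambda>\<phi>. if \<phi> \<in> Y then \<phi> x else 0)"

definition is_predual :: "'v::real_vector set \<Rightarrow> ('v \<Rightarrow> real) \<Rightarrow> ('v \<Rightarrow> real) set \<Rightarrow> bool"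
  where "is_predual X N Y \<longleftrightarrow>
    closed_subspace_of (dual_space X N) (dual_norm X N) Y \<and>
    linear_on_carrier X (evaluation Y) \<and>
    (\<forall>x\<in>X. dual_norm Y (dual_norm X N) (evaluation Y x) = N x) \<and>
    evaluation Y ` X = dual_space Y (dual_norm X N)"

definition has_strongly_unique_predual :: "'v::real_vector set \<Rightarrow> ('v \<Rightarrow> real) \<Rightarrow> bool"
  where "has_strongly_unique_predual X N \<longleftrightarrow> (\<exists>!Y. is_predual X N Y)"

definition Lip0 :: "'a::metric_space set \<Rightarrow> 'a \<Rightarrow> ('a \<Rightarrow> real) set"
  where "Lip0 M p = {f. (\<exists>L. L-lipschitz_on M f) \<and> f p = 0 \<and> (\<forall>x. x \<notin> M \<longrightarrow> f x = 0)}"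

text \<open>
  The element \<open>0\<close> matters only if \<open>M\<close> is a singleton, where the set of quotients is empty;
  otherwise that set is symmetric and its supremum is nonnegative anyway.
\<close>

definition lip_norm :: "'a::metric_space set \<Rightarrow> ('a \<Rightarrow> real) \<Rightarrow> real"
  where "lip_norm M f =
    Sup (insert 0 {(f x - f y) / dist x y | x y. x \<in> M \<and> y \<in> M \<and> x \<noteq> y})"

end

theory Submission
  imports Defs
begin

text \<open>
  The closed span of the point evaluations is a predual. Let \<open>Y\<close> be any predual; since a predual
  contained in another one equals it, it suffices to show that every functional in \<open>Y\<close> is
  continuous for convergence on bounded sets, i.e. that every weak* cluster point \<open>F\<close> (with respect
  to \<open>Y\<close>) of a sequence in the unit ball converging to 0 uniformly on bounded sets vanishes.
  The only sets known to be weak* closed for every predual are the intersections of balls, but they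
  include the sets of functions which are constant near a given point. Consequently cutting off the
  sequence outside a neighbourhood of a set cuts off the gradient of \<open>F\<close> there.

  If \<open>M\<close> is not contained in a line, cut off to a thin neighbourhood of a segment from \<open>a\<close> to \<open>b\<close>: the
  limit is constant on a parallel segment outside the neighbourhood, has norm at most 2, and
  differs from \<open>F\<close> by a constant on the segment itself, so \<open>F a = F b\<close>.

  If \<open>M\<close> is contained in a line, then the space is isometric to a space of essentially bounded
  functions. If \<open>F\<close> did not vanish, some functional in \<open>Y\<close> would be bounded below by a positive
  number on functions that are uniformly small, hence on averages of them whose derivatives tend
  to 0 in mean square. A subsequence of these is dominated in the sense of derivatives
  by functions decreasing to 0, and order intervals are intersections of balls, so the averages
  tend to 0 in the weak* topology of \<open>Y\<close>, a contradiction.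
\<close>

section \<open>Normed carriers and preduals\<close>

lemma scaleR_fun_apply [simp]: "(c *\<^sub>R f) x = c *\<^sub>R f x"
  by (simp add: scaleR_fun_def)

section \<open>Normed spaces on a carrier and their duals\<close>

locale normed_carrier =
  fixes X :: "'v::real_vector set" and N :: "'v \<Rightarrow> real"
  assumes subspace_carrier: "subspace X"
    and norm_triangle: "x \<in> X \<Longrightarrow> y \<in> X \<Longrightarrow> N (x + y) \<le> N x + N y"
    and norm_scale: "x \<in> X \<Longrightarrow> N (c *\<^sub>R x) = \<bar>c\<bar> * N x"
    and norm_definite: "x \<in> X \<Longrightarrow> N x = 0 \<Longrightarrow> x = 0"
begin

lemma carrier_closed [simp, intro]:
  "0 \<in> X"
  "x \<in> X \<Longrightarrow> y \<in> X \<Longrightarrow> x + y \<in> X"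
  "x \<in> X \<Longrightarrow> y \<in> X \<Longrightarrow> x - y \<in> X"
  "x \<in> X \<Longrightarrow> c *\<^sub>R x \<in> X"
  "x \<in> X \<Longrightarrow> - x \<in> X"
  using subspace_carrier
  by (auto intro: subspace_0 subspace_add subspace_diff subspace_scale subspace_neg)

lemma norm_zero [simp]: "N 0 = 0"
  using norm_scale[of 0 0] by simp

lemma norm_uminus [simp]: "x \<in> X \<Longrightarrow> N (- x) = N x"
  using norm_scale[of x "-1"] by simp

lemma norm_nonneg [simp]: "x \<in> X \<Longrightarrow> 0 \<le> N x"
  using norm_triangle[of x "- x"] by simp

lemma dual_spaceD:
  assumes "\<phi> \<in> dual_space X N"
  shows "x \<in> X \<Longrightarrow> y \<in> X \<Longrightarrow> \<phi> (x + y) = \<phi> x + \<phi> y"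
    and "x \<in> X \<Longrightarrow> \<phi> (c *\<^sub>R x) = c * \<phi> x"
    and "x \<in> X \<Longrightarrow> y \<in> X \<Longrightarrow> \<phi> (x - y) = \<phi> x - \<phi> y"
    and "\<phi> 0 = 0"
    and "x \<notin> X \<Longrightarrow> \<phi> x = 0"
proof -
  show add: "\<phi> (x + y) = \<phi> x + \<phi> y" if "x \<in> X" "y \<in> X" for x y
    using assms that by (auto simp: dual_space_def linear_on_carrier_def)
  show sc: "\<phi> (c *\<^sub>R x) = c * \<phi> x" if "x \<in> X" for x c
    using assms that by (auto simp: dual_space_def linear_on_carrier_def)
  show "\<phi> (x - y) = \<phi> x - \<phi> y" if "x \<in> X" "y \<in> X"
    using add[of x "-1 *\<^sub>R y"] sc[of y "-1"] that by simp
  show "\<phi> 0 = 0" using sc[of 0 0] by simp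
  show "x \<notin> X \<Longrightarrow> \<phi> x = 0" using assms by (auto simp: dual_space_def)
qed

lemma dual_spaceI:
  assumes "\<And>x y. x \<in> X \<Longrightarrow> y \<in> X \<Longrightarrow> \<phi> (x + y) = \<phi> x + \<phi> y"
    and "\<And>c x. x \<in> X \<Longrightarrow> \<phi> (c *\<^sub>R x) = c * \<phi> x"
    and "\<And>x. x \<in> X \<Longrightarrow> \<bar>\<phi> x\<bar> \<le> C * N x"
    and "\<And>x. x \<notin> X \<Longrightarrow> \<phi> x = 0"
  shows "\<phi> \<in> dual_space X N"
  unfolding dual_space_def linear_on_carrier_def using assms by (auto intro!: exI[of _ C])

lemma dual_norm_bdd:
  assumes "\<phi> \<in> dual_space X N"
  shows "bdd_above {\<bar>\<phi> x\<bar> | x. x \<in> X \<and> N x \<le> 1}"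
proof -
  obtain C where C: "\<And>x. x \<in> X \<Longrightarrow> \<bar>\<phi> x\<bar> \<le> C * N x"
    using assms by (auto simp: dual_space_def)
  show ?thesis
  proof (rule bdd_aboveI[of _ "\<bar>C\<bar>"], clarify)
    fix x assume x: "x \<in> X" "N x \<le> 1"
    have "\<bar>\<phi> x\<bar> \<le> \<bar>C\<bar> * N x"
      using C[OF x(1)] norm_nonneg[OF x(1)] by (smt (verit) mult_right_mono)
    also have "\<dots> \<le> \<bar>C\<bar> * 1" using x by (intro mult_left_mono) auto
    finally show "\<bar>\<phi> x\<bar> \<le> \<bar>C\<bar>" by simp
  qed
qed

lemma dual_norm_upper:
  assumes "\<phi> \<in> dual_space X N" "x \<in> X" "N x \<le> 1"
  shows "\<bar>\<phi> x\<bar> \<le> dual_norm X N \<phi>"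
  unfolding dual_norm_def using assms by (intro cSup_upper dual_norm_bdd) auto

lemma dual_norm_nonneg [simp]:
  assumes "\<phi> \<in> dual_space X N"
  shows "0 \<le> dual_norm X N \<phi>"
  using dual_norm_upper[OF assms, of 0] by simp

lemma dual_norm_bound:
  assumes "\<phi> \<in> dual_space X N" "x \<in> X"
  shows "\<bar>\<phi> x\<bar> \<le> dual_norm X N \<phi> * N x"
proof (cases "N x = 0")
  case True
  then show ?thesis using norm_definite dual_spaceD(4)[OF assms(1)] assms(2) by auto
next
  case False
  then have pos: "N x > 0" using norm_nonneg[OF assms(2)] by simp
  have "\<bar>\<phi> ((1 / N x) *\<^sub>R x)\<bar> \<le> dual_norm X N \<phi>"
    using assms pos by (intro dual_norm_upper) (auto simp: norm_scale)
  then show ?thesis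
    using pos assms by (simp add: dual_spaceD abs_mult field_simps)
qed

lemma dual_norm_le:
  assumes "\<And>x. x \<in> X \<Longrightarrow> \<bar>\<phi> x\<bar> \<le> C * N x" "0 \<le> C"
  shows "dual_norm X N \<phi> \<le> C"
  unfolding dual_norm_def
proof (rule cSup_least)
  show "{\<bar>\<phi> x\<bar> | x. x \<in> X \<and> N x \<le> 1} \<noteq> {}" by (auto intro!: exI[of _ 0])
  fix r assume "r \<in> {\<bar>\<phi> x\<bar> | x. x \<in> X \<and> N x \<le> 1}"
  then obtain x where x: "x \<in> X" "N x \<le> 1" "r = \<bar>\<phi> x\<bar>" by auto
  have "C * N x \<le> C * 1" using x assms by (intro mult_left_mono) auto
  then show "r \<le> C" using assms(1)[OF x(1)] x by simp
qed

lemma dual_space_add: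
  assumes "\<phi> \<in> dual_space X N" "\<psi> \<in> dual_space X N"
  shows "\<phi> + \<psi> \<in> dual_space X N"
proof (rule dual_spaceI[where C = "dual_norm X N \<phi> + dual_norm X N \<psi>"])
  fix x assume x: "x \<in> X"
  show "\<bar>(\<phi> + \<psi>) x\<bar> \<le> (dual_norm X N \<phi> + dual_norm X N \<psi>) * N x"
    using dual_norm_bound[OF assms(1) x] dual_norm_bound[OF assms(2) x]
    by (simp add: algebra_simps)
qed (use assms in \<open>auto simp: dual_spaceD algebra_simps\<close>)

lemma dual_space_scale:
  assumes "\<phi> \<in> dual_space X N"
  shows "c *\<^sub>R \<phi> \<in> dual_space X N"
proof (rule dual_spaceI[where C = "\<bar>c\<bar> * dual_norm X N \<phi>"])
  fix x assume x: "x \<in> X"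
  show "\<bar>(c *\<^sub>R \<phi>) x\<bar> \<le> (\<bar>c\<bar> * dual_norm X N \<phi>) * N x"
    using mult_left_mono[OF dual_norm_bound[OF assms(1) x], of "\<bar>c\<bar>"]
    by (simp add: abs_mult mult.assoc)
qed (use assms in \<open>auto simp: dual_spaceD algebra_simps\<close>)

lemma subspace_dual_space: "subspace (dual_space X N)"
  unfolding subspace_def
  using dual_space_add dual_space_scale dual_spaceI[of 0 0] by simp

text \<open>Moves the theory one level up: a space of functionals is again a normed carrier, so the
  lemmas on \<open>dual_space\<close> also apply to functionals on a candidate predual.\<close>

lemma normed_carrier_dual:
  assumes "subspace Y" "Y \<subseteq> dual_space X N"
  shows "normed_carrier Y (dual_norm X N)"
proof
  show "subspace Y" by fact
  have D: "\<phi> \<in> dual_space X N" if "\<phi> \<in> Y" for \<phi> using that assms by auto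
  show "dual_norm X N (\<phi> + \<psi>) \<le> dual_norm X N \<phi> + dual_norm X N \<psi>"
    if "\<phi> \<in> Y" "\<psi> \<in> Y" for \<phi> \<psi>
  proof (rule dual_norm_le)
    fix x assume x: "x \<in> X"
    show "\<bar>(\<phi> + \<psi>) x\<bar> \<le> (dual_norm X N \<phi> + dual_norm X N \<psi>) * N x"
      using dual_norm_bound[OF D[OF that(1)] x] dual_norm_bound[OF D[OF that(2)] x]
      by (simp add: algebra_simps)
  qed (use that D in auto)
  have le: "dual_norm X N (c *\<^sub>R \<phi>) \<le> \<bar>c\<bar> * dual_norm X N \<phi>" if "\<phi> \<in> Y" for c \<phi>
  proof (rule dual_norm_le)
    fix x assume x: "x \<in> X"
    show "\<bar>(c *\<^sub>R \<phi>) x\<bar> \<le> (\<bar>c\<bar> * dual_norm X N \<phi>) * N x"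
      using mult_left_mono[OF dual_norm_bound[OF D[OF that] x], of "\<bar>c\<bar>"]
      by (simp add: abs_mult mult.assoc)
  qed (use that D in auto)
  show "dual_norm X N (c *\<^sub>R \<phi>) = \<bar>c\<bar> * dual_norm X N \<phi>" if "\<phi> \<in> Y" for c \<phi>
  proof (cases "c = 0")
    case True
    then show ?thesis
      using le[OF that, of 0] dual_norm_nonneg[OF D[OF subspace_0[OF assms(1)]]] by simp
  next
    case False
    have "dual_norm X N \<phi> = dual_norm X N ((1 / c) *\<^sub>R (c *\<^sub>R \<phi>))" using False by simp
    also have "\<dots> \<le> \<bar>1 / c\<bar> * dual_norm X N (c *\<^sub>R \<phi>)"
      using that assms(1) by (intro le subspace_scale)
    finally have "\<bar>c\<bar> * dual_norm X N \<phi> \<le> dual_norm X N (c *\<^sub>R \<phi>)"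
      using False by (simp add: field_simps)
    then show ?thesis using le[OF that, of c] by simp
  qed
  show "\<phi> = 0" if "\<phi> \<in> Y" "dual_norm X N \<phi> = 0" for \<phi>
  proof
    fix x show "\<phi> x = 0 x"
      using dual_norm_bound[OF D[OF that(1)], of x] that(2) dual_spaceD(5)[OF D[OF that(1)], of x]
      by (cases "x \<in> X") auto
  qed
qed

text \<open>Finitely many one-dimensional Hahn-Banach extensions replace the general theorem.\<close>

lemma approx_by_span_of_finite:
  assumes \<phi>: "\<phi> \<in> dual_space X N" and "0 \<le> \<epsilon>"
    and "finite \<Phi>" "\<Phi> \<subseteq> dual_space X N"
    and "\<And>x. x \<in> X \<Longrightarrow> (\<forall>\<psi>\<in>\<Phi>. \<psi> x = 0) \<Longrightarrow> \<bar>\<phi> x\<bar> \<le> \<epsilon> * N x"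
  shows "\<exists>y\<in>span \<Phi>. \<forall>x\<in>X. \<bar>\<phi> x - y x\<bar> \<le> \<epsilon> * N x"
  using assms(3,1,4,5)
proof (induction \<Phi> arbitrary: \<phi> rule: finite_induct)
  case empty
  then show ?case by auto
next
  case (insert \<psi> \<Phi>)
  let ?V = "{x \<in> X. \<forall>\<psi>\<in>\<Phi>. \<psi> x = 0}"
  have \<psi>: "\<psi> \<in> dual_space X N" and \<Phi>: "\<And>\<theta>. \<theta> \<in> \<Phi> \<Longrightarrow> \<theta> \<in> dual_space X N"
    using insert.prems by auto
  have bound: "\<bar>\<phi> x\<bar> \<le> \<epsilon> * N x" if "x \<in> ?V" "\<psi> x = 0" for x
    using insert.prems(3) that by auto
  \<comment> \<open>\<open>?V\<close> is the common kernel of the functionals covered by the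
    induction hypothesis. Subtracting the right multiple of \<open>\<psi>\<close> extends the bound
    from the kernel of \<open>\<psi>\<close> in \<open>?V\<close> to all of
    \<open>?V\<close>.\<close>
  have "\<exists>c. \<forall>x\<in>?V. \<bar>\<phi> x - c * \<psi> x\<bar> \<le> \<epsilon> * N x"
  proof (cases "\<forall>x\<in>?V. \<psi> x = 0")
    case True
    then show ?thesis using bound by auto
  next
    case False
    then obtain w where w: "w \<in> ?V" "\<psi> w \<noteq> 0" by blast
    define e where "e = (1 / \<psi> w) *\<^sub>R w"
    have e: "e \<in> ?V" "\<psi> e = 1"
      using w \<Phi> \<psi> by (auto simp: e_def dual_spaceD)
    let ?K = "{x \<in> ?V. \<psi> x = 0}"
    \<comment> \<open>The admissible values of \<open>c\<close> form an interval: every lower bound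
      lies below every upper bound because \<open>v - u\<close> is the difference of
      \<open>e + v\<close> and \<open>e + u\<close>.\<close>
    have sep: "\<phi> e + \<phi> v - \<epsilon> * N (e + v) \<le> \<phi> e + \<phi> u + \<epsilon> * N (e + u)" if "u \<in> ?K" "v \<in> ?K" for u v
    proof -
      have uv: "v - u \<in> ?V" "\<psi> (v - u) = 0" using that \<Phi> \<psi> by (auto simp: dual_spaceD)
      have "\<phi> v - \<phi> u \<le> \<epsilon> * N (v - u)"
        using bound[OF uv] that insert.prems(1) by (auto simp: dual_spaceD)
      also have "\<epsilon> * N (v - u) \<le> \<epsilon> * (N (e + v) + N (e + u))"
        using assms(2) norm_triangle[of "e + v" "- (e + u)"] norm_uminus[of "e + u"] that e
        by (intro mult_left_mono) auto
      finally show ?thesis by (simp add: distrib_left)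
    qed
    define c where "c = Sup ((\<lambda>v. \<phi> e + \<phi> v - \<epsilon> * N (e + v)) ` ?K)"
    have K0: "0 \<in> ?K" using \<Phi> \<psi> by (auto simp: dual_spaceD)
    have c1: "\<phi> e + \<phi> v - \<epsilon> * N (e + v) \<le> c" if "v \<in> ?K" for v
      unfolding c_def using that sep[OF K0] by (intro cSup_upper imageI bdd_aboveI2)
    have c2: "c \<le> \<phi> e + \<phi> v + \<epsilon> * N (e + v)" if "v \<in> ?K" for v
      unfolding c_def using that sep K0 by (intro cSup_least) auto
    have "\<bar>\<phi> x - c * \<psi> x\<bar> \<le> \<epsilon> * N x" if x: "x \<in> ?V" for x
    proof (cases "\<psi> x = 0")
      case True
      then show ?thesis using bound x by auto
    next
      case False
      define v where "v = (1 / \<psi> x) *\<^sub>R x - e"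
      have v: "v \<in> ?K" using x e \<Phi> \<psi> False by (auto simp: v_def dual_spaceD)
      have xe: "x = \<psi> x *\<^sub>R (e + v)" using False by (simp add: v_def)
      have ev: "e + v \<in> X" using e v by auto
      have "\<phi> x = \<psi> x * (\<phi> e + \<phi> v)"
        using insert.prems(1) e v by (subst xe) (auto simp: dual_spaceD)
      then have "\<bar>\<phi> x - c * \<psi> x\<bar> = \<bar>\<psi> x\<bar> * \<bar>\<phi> e + \<phi> v - c\<bar>"
        by (simp add: abs_mult[symmetric] algebra_simps)
      also have "\<dots> \<le> \<bar>\<psi> x\<bar> * (\<epsilon> * N (e + v))"
        using c1[OF v] c2[OF v] by (intro mult_left_mono) auto
      also have "\<dots> = \<epsilon> * N x"
        using norm_scale[OF ev, of "\<psi> x"] xe by simp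
      finally show ?thesis .
    qed
    then show ?thesis by blast
  qed
  then obtain c where c: "\<And>x. x \<in> ?V \<Longrightarrow> \<bar>\<phi> x - c * \<psi> x\<bar> \<le> \<epsilon> * N x" by blast
  have "\<phi> - c *\<^sub>R \<psi> \<in> dual_space X N"
    using insert.prems(1) \<psi> subspace_dual_space by (intro subspace_diff subspace_scale)
  from insert.IH[OF this] obtain y where y: "y \<in> span \<Phi>"
    "\<And>x. x \<in> X \<Longrightarrow> \<bar>(\<phi> - c *\<^sub>R \<psi>) x - y x\<bar> \<le> \<epsilon> * N x"
    using insert.prems c by auto
  have "y + c *\<^sub>R \<psi> \<in> span (insert \<psi> \<Phi>)"
    using y(1) by (meson insertI1 span_add span_base span_mono span_scale subsetD subset_insertI)
  moreover have "\<bar>\<phi> x - (y + c *\<^sub>R \<psi>) x\<bar> \<le> \<epsilon> * N x" if "x \<in> X" for x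
    using y(2)[OF that] by (simp add: algebra_simps)
  ultimately show ?case by blast
qed

text \<open>Translates closedness, which is stated through balls in the complement, into stability
  under approximation measured pointwise on \<open>X\<close>.\<close>

lemma dual_mem_closed_subspace:
  assumes "closed_subspace_of (dual_space X N) (dual_norm X N) Y" "\<phi> \<in> dual_space X N"
    and "\<And>\<epsilon>. \<epsilon> > 0 \<Longrightarrow> \<exists>y\<in>Y. \<forall>x\<in>X. \<bar>\<phi> x - y x\<bar> \<le> \<epsilon> * N x"
  shows "\<phi> \<in> Y"
proof (rule ccontr)
  assume "\<phi> \<notin> Y"
  then obtain \<epsilon> where \<epsilon>: "\<epsilon> > 0"
    "\<And>z. z \<in> dual_space X N \<Longrightarrow> dual_norm X N (z - \<phi>) < \<epsilon> \<Longrightarrow> z \<notin> Y"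
    using assms(1,2) unfolding closed_subspace_of_def by blast
  \<comment> \<open>Half of \<open>\<epsilon>\<close>, because the pointwise estimate yields only a
    non-strict bound for the dual norm.\<close>
  obtain y where y: "y \<in> Y" "\<And>x. x \<in> X \<Longrightarrow> \<bar>\<phi> x - y x\<bar> \<le> \<epsilon> / 2 * N x"
    using assms(3)[of "\<epsilon> / 2"] \<epsilon>(1) by auto
  have "dual_norm X N (y - \<phi>) \<le> \<epsilon> / 2"
    using y(2) \<epsilon>(1) by (intro dual_norm_le) (auto simp: abs_minus_commute)
  then show False
    using \<epsilon> y(1) assms(1) unfolding closed_subspace_of_def by (smt (verit) field_sum_of_halves subsetD)
qed

end

section \<open>Weak* convergence with respect to a given predual\<close>

locale predual = normed_carrier X N
  for X :: "'v::real_vector set" and N +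
  fixes Y :: "('v \<Rightarrow> real) set"
  assumes is_predual: "is_predual X N Y"
begin

lemma predual_closed: "closed_subspace_of (dual_space X N) (dual_norm X N) Y"
  using is_predual by (auto simp: is_predual_def)

lemma predual_subspace: "subspace Y"
  and predual_dual: "\<psi> \<in> Y \<Longrightarrow> \<psi> \<in> dual_space X N"
  using predual_closed by (auto simp: closed_subspace_of_def)

sublocale dual: normed_carrier Y "dual_norm X N"
  using normed_carrier_dual predual_subspace predual_dual by auto

text \<open>The isometry clause of \<open>is_predual\<close>, read as: \<open>Y\<close> is norming
  for \<open>X\<close>.\<close>

lemma norm_le_by_predual:
  assumes "x \<in> X" "0 \<le> C" "\<And>\<psi>. \<psi> \<in> Y \<Longrightarrow> \<bar>\<psi> x\<bar> \<le> C * dual_norm X N \<psi>"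
  shows "N x \<le> C"
proof -
  have "N x = dual_norm Y (dual_norm X N) (evaluation Y x)"
    using is_predual assms(1) by (simp add: is_predual_def)
  also have "\<dots> \<le> C"
    using assms by (intro dual.dual_norm_le) (auto simp: evaluation_def)
  finally show ?thesis .
qed

lemma predual_separates:
  assumes "x \<in> X" "\<And>\<psi>. \<psi> \<in> Y \<Longrightarrow> \<psi> x = 0"
  shows "x = 0"
  using norm_le_by_predual[of x 0] norm_definite[of x] norm_nonneg[of x] assms by (simp add: antisym)

text \<open>The surjectivity clause of \<open>is_predual\<close>; it turns a limit computed on
  \<open>Y\<close> back into a vector.\<close>

lemma predual_represents:
  assumes "\<And>\<psi> \<theta>. \<psi> \<in> Y \<Longrightarrow> \<theta> \<in> Y \<Longrightarrow> \<Lambda> (\<psi> + \<theta>) = \<Lambda> \<psi> + \<Lambda> \<theta>"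
    and "\<And>c \<psi>. \<psi> \<in> Y \<Longrightarrow> \<Lambda> (c *\<^sub>R \<psi>) = c * \<Lambda> \<psi>"
    and "\<And>\<psi>. \<psi> \<in> Y \<Longrightarrow> \<bar>\<Lambda> \<psi>\<bar> \<le> C * dual_norm X N \<psi>"
  obtains x where "x \<in> X" "\<And>\<psi>. \<psi> \<in> Y \<Longrightarrow> \<psi> x = \<Lambda> \<psi>"
proof -
  \<comment> \<open>Extension by zero, since the members of \<open>dual_space\<close> vanish off the
    carrier, here \<open>Y\<close>.\<close>
  define \<Lambda>' where "\<Lambda>' \<psi> = (if \<psi> \<in> Y then \<Lambda> \<psi> else 0)" for \<psi>
  have "\<Lambda>' \<in> dual_space Y (dual_norm X N)"
    using assms by (intro dual.dual_spaceI[where C = C]) (auto simp: \<Lambda>'_def)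
  then obtain x where "x \<in> X" "\<Lambda>' = evaluation Y x"
    using is_predual by (auto simp: is_predual_def)
  then have "\<psi> x = \<Lambda> \<psi>" if "\<psi> \<in> Y" for \<psi>
    using that by (metis \<Lambda>'_def evaluation_def)
  then show ?thesis using that \<open>x \<in> X\<close> by blast
qed

text \<open>Convergence in the weak* topology that \<open>Y\<close> induces on \<open>X\<close>.
  Arbitrary filters are allowed, so that passing to a subnet becomes passing to a finer
  filter.\<close>

definition weak_tendsto :: "('i \<Rightarrow> 'v) \<Rightarrow> 'v \<Rightarrow> 'i filter \<Rightarrow> bool"
  where "weak_tendsto g x G \<longleftrightarrow> x \<in> X \<and> (\<forall>\<psi>\<in>Y. ((\<lambda>i. \<psi> (g i)) \<longlongrightarrow> \<psi> x) G)"

lemma weak_tendsto_mono: "weak_tendsto g x G \<Longrightarrow> G' \<le> G \<Longrightarrow> weak_tendsto g x G'"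
  by (auto simp: weak_tendsto_def intro: tendsto_mono)

lemma weak_tendsto_diff:
  assumes "weak_tendsto g x G" "weak_tendsto h y G" "\<And>i. g i \<in> X" "\<And>i. h i \<in> X"
  shows "weak_tendsto (\<lambda>i. g i - h i) (x - y) G"
  using assms by (auto simp: weak_tendsto_def dual_spaceD predual_dual intro!: tendsto_diff)

text \<open>Closed balls with any centre are weak* closed, because the norm is determined by bounds
  on the functionals in \<open>Y\<close>.\<close>

lemma weak_tendsto_norm_le:
  assumes "weak_tendsto g x G" "G \<noteq> bot" "\<And>i. g i \<in> X" "h \<in> X"
    and "\<forall>\<^sub>F i in G. N (g i - h) \<le> R"
  shows "N (x - h) \<le> R"
proof (rule norm_le_by_predual)
  have x: "x \<in> X" using assms(1) by (auto simp: weak_tendsto_def)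
  show "x - h \<in> X" using x assms by auto
  obtain i where "N (g i - h) \<le> R"
    using eventually_happens[OF assms(5)] assms(2) by blast
  then show "0 \<le> R" using norm_nonneg[of "g i - h"] assms by (metis carrier_closed(3) order_trans)
  fix \<psi> assume \<psi>: "\<psi> \<in> Y"
  have "((\<lambda>i. \<bar>\<psi> (g i) - \<psi> h\<bar>) \<longlongrightarrow> \<bar>\<psi> x - \<psi> h\<bar>) G"
    using assms(1) \<psi> by (auto simp: weak_tendsto_def intro!: tendsto_intros)
  moreover have "\<forall>\<^sub>F i in G. \<bar>\<psi> (g i) - \<psi> h\<bar> \<le> R * dual_norm X N \<psi>"
    using assms(5)
  proof eventually_elim
    case (elim i)
    have "\<bar>\<psi> (g i - h)\<bar> \<le> dual_norm X N \<psi> * N (g i - h)"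
      using \<psi> assms by (intro dual_norm_bound predual_dual) auto
    also have "\<dots> \<le> dual_norm X N \<psi> * R"
      using elim \<psi> by (intro mult_left_mono) (auto simp: predual_dual)
    finally show ?case using assms \<psi> by (simp add: dual_spaceD predual_dual mult.commute)
  qed
  ultimately have "\<bar>\<psi> x - \<psi> h\<bar> \<le> R * dual_norm X N \<psi>"
    using assms(2) tendsto_upperbound by blast
  then show "\<bar>\<psi> (x - h)\<bar> \<le> R * dual_norm X N \<psi>"
    using x \<psi> assms by (simp add: dual_spaceD predual_dual)
qed

text \<open>Banach-Alaoglu in filter form: Tychonoff's theorem gives a cluster point of the families
  of values on \<open>Y\<close>, linearity and boundedness pass to it, and surjectivity represents
  it by a vector.\<close>

lemma bounded_weak_cluster:
  fixes g :: "'i \<Rightarrow> 'v"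
  assumes "G \<noteq> bot" "\<And>i. g i \<in> X" "\<And>i. N (g i) \<le> C"
  obtains G' x where "G' \<le> G" "G' \<noteq> bot" "weak_tendsto g x G'"
proof -
  \<comment> \<open>Off \<open>Y\<close> the factor is a single point, so that the product over all
    functions is still compact.\<close>
  define K where "K = PiE UNIV (\<lambda>\<psi>. if \<psi> \<in> Y then {- C * dual_norm X N \<psi>..C * dual_norm X N \<psi>} else {0})"
  define T where "T i = (\<lambda>\<psi>. if \<psi> \<in> Y then \<psi> (g i) else 0)" for i
  have "compactin (product_topology (\<lambda>_. euclidean) UNIV) K"
    unfolding K_def by (subst compactin_PiE) auto
  then have "compact K"
    using euclidean_product_topology compactin_euclidean_iff by metis
  have TK: "T i \<in> K" for i
  proof -
    have "\<bar>\<psi> (g i)\<bar> \<le> C * dual_norm X N \<psi>" if "\<psi> \<in> Y" for \<psi>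
      using dual_norm_bound[OF predual_dual[OF that] assms(2)[of i]]
        mult_left_mono[OF assms(3)[of i] dual_norm_nonneg[OF predual_dual[OF that]]]
      by (simp add: mult.commute)
    then show ?thesis by (fastforce simp: K_def T_def PiE_iff)
  qed
  have "filtermap T G \<noteq> bot" "filtermap T G \<le> principal K"
    using assms(1) TK by (auto simp: filtermap_bot_iff le_principal eventually_filtermap)
  then obtain \<Lambda> where \<Lambda>: "\<Lambda> \<in> K" "inf (nhds \<Lambda>) (filtermap T G) \<noteq> bot"
    using \<open>compact K\<close>[unfolded compact_filter, rule_format, of "filtermap T G"]
    by (auto simp: le_principal)
  \<comment> \<open>Refining \<open>G\<close> by preimages of neighbourhoods of
    \<open>\<Lambda>\<close> turns the cluster point into a limit.\<close>
  define G' where "G' = inf (filtercomap T (nhds \<Lambda>)) G"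
  have nb: "G' \<noteq> bot"
  proof
    assume "G' = bot"
    then have "eventually (\<lambda>_. False) (inf (filtercomap T (nhds \<Lambda>)) G)" by (simp add: G'_def)
    then obtain P Q where PQ: "eventually P (nhds \<Lambda>)" "eventually Q G" "\<And>i. P (T i) \<Longrightarrow> Q i \<Longrightarrow> False"
      by (auto simp: eventually_inf eventually_filtercomap)
    have "eventually (\<lambda>t. \<not> P t) (filtermap T G)"
      using PQ(2) by (auto simp: eventually_filtermap elim!: eventually_mono dest: PQ(3))
    then have "eventually (\<lambda>_. False) (inf (nhds \<Lambda>) (filtermap T G))"
      using PQ(1) unfolding eventually_inf by blast
    then show False using \<Lambda>(2) by (simp add: trivial_limit_def)
  qed
  have "(T \<longlongrightarrow> \<Lambda>) G'"
    unfolding G'_def filterlim_iff_le_filtercomap by simp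
  then have lim: "((\<lambda>i. T i \<psi>) \<longlongrightarrow> \<Lambda> \<psi>) G'" for \<psi>
    by (rule continuous_on_tendsto_compose[OF continuous_on_product_coordinates]) auto
  have lim': "((\<lambda>i. \<psi> (g i)) \<longlongrightarrow> \<Lambda> \<psi>) G'" if "\<psi> \<in> Y" for \<psi>
    using lim[of \<psi>] that by (simp add: T_def)
  obtain x where x: "x \<in> X" "\<And>\<psi>. \<psi> \<in> Y \<Longrightarrow> \<psi> x = \<Lambda> \<psi>"
  proof (rule predual_represents[where C = C and \<Lambda> = \<Lambda>])
    show "\<Lambda> (\<psi> + \<theta>) = \<Lambda> \<psi> + \<Lambda> \<theta>" if "\<psi> \<in> Y" "\<theta> \<in> Y" for \<psi> \<theta>
      using tendsto_unique[OF nb lim'[of "\<psi> + \<theta>"]] tendsto_add[OF lim'[of \<psi>] lim'[of \<theta>]] that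
      by auto
    show "\<Lambda> (c *\<^sub>R \<psi>) = c * \<Lambda> \<psi>" if "\<psi> \<in> Y" for c \<psi>
      using tendsto_unique[OF nb lim'[of "c *\<^sub>R \<psi>"]] tendsto_mult_left[OF lim'[of \<psi>]] that
      by auto
    show "\<bar>\<Lambda> \<psi>\<bar> \<le> C * dual_norm X N \<psi>" if "\<psi> \<in> Y" for \<psi>
      using PiE_mem[OF \<Lambda>(1)[unfolded K_def], of \<psi>] that by auto
  qed blast
  then have "weak_tendsto g x G'" using lim' by (auto simp: weak_tendsto_def)
  moreover have "G' \<le> G" by (simp add: G'_def)
  ultimately show ?thesis using that nb by blast
qed

end

text \<open>
  An element of the larger predual that is not approximable from the smaller one would be large
  on a bounded net annihilated by the smaller one; a cluster point of that net is a nonzero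
  vector on which the smaller predual vanishes.
\<close>

lemma preduals_eq_if_subset:
  assumes "predual X N Y" "predual X N Z" "Y \<subseteq> Z"
  shows "Y = Z"
proof (rule ccontr)
  interpret Y: predual X N Y by fact
  interpret Z: predual X N Z by fact
  assume "Y \<noteq> Z"
  then obtain \<phi> where \<phi>: "\<phi> \<in> Z" "\<phi> \<notin> Y" using assms(3) by auto
  then obtain \<epsilon> where \<epsilon>: "\<epsilon> > 0" "\<And>y. y \<in> Y \<Longrightarrow> \<exists>x\<in>X. \<bar>\<phi> x - y x\<bar> > \<epsilon> * N x"
    using Y.dual_mem_closed_subspace[OF Y.predual_closed Z.predual_dual[OF \<phi>(1)]]
    by (meson not_le)
  \<comment> \<open>Otherwise \<open>approx_by_span_of_finite\<close> would bring
    \<open>\<phi>\<close> within \<open>\<epsilon>\<close> of the span of \<open>\<Phi>\<close>,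
    which lies in \<open>Y\<close>.\<close>
  have "\<exists>x\<in>X. N x \<le> 1 \<and> (\<forall>\<psi>\<in>\<Phi>. \<psi> x = 0) \<and> \<bar>\<phi> x\<bar> \<ge> \<epsilon>" if \<Phi>: "finite \<Phi>" "\<Phi> \<subseteq> Y" for \<Phi>
  proof -
    have "\<exists>x\<in>X. (\<forall>\<psi>\<in>\<Phi>. \<psi> x = 0) \<and> \<bar>\<phi> x\<bar> > \<epsilon> * N x"
    proof (rule ccontr)
      assume "\<not> ?thesis"
      then have "\<exists>y\<in>span \<Phi>. \<forall>x\<in>X. \<bar>\<phi> x - y x\<bar> \<le> \<epsilon> * N x"
        using \<Phi> \<epsilon>(1) Y.predual_dual Z.predual_dual[OF \<phi>(1)]
        by (intro Y.approx_by_span_of_finite) (auto simp: not_less)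
      moreover have "span \<Phi> \<subseteq> Y" using \<Phi>(2) Y.predual_subspace by (simp add: span_minimal)
      ultimately show False using \<epsilon>(2) by (meson not_le subsetD)
    qed
    then obtain x where x: "x \<in> X" "\<forall>\<psi>\<in>\<Phi>. \<psi> x = 0" "\<bar>\<phi> x\<bar> > \<epsilon> * N x" by blast
    have "N x \<noteq> 0"
      using x Y.norm_definite[OF x(1)] Y.dual_spaceD(4)[OF Z.predual_dual[OF \<phi>(1)]] by auto
    then have pos: "N x > 0" using Y.norm_nonneg[OF x(1)] by simp
    have "\<psi> ((1 / N x) *\<^sub>R x) = 0" if "\<psi> \<in> \<Phi>" for \<psi>
      using that \<Phi>(2) x Y.predual_dual by (auto simp: Y.dual_spaceD)
    moreover have "\<bar>\<phi> ((1 / N x) *\<^sub>R x)\<bar> \<ge> \<epsilon>"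
      using x pos Z.predual_dual[OF \<phi>(1)] by (simp add: Y.dual_spaceD abs_mult field_simps)
    ultimately show ?thesis
      using x(1) pos by (intro bexI[of _ "(1 / N x) *\<^sub>R x"]) (auto simp: Y.norm_scale)
  qed
  then obtain g where g: "\<And>\<Phi>. finite \<Phi> \<Longrightarrow> \<Phi> \<subseteq> Y \<Longrightarrow>
      g \<Phi> \<in> X \<and> N (g \<Phi>) \<le> 1 \<and> (\<forall>\<psi>\<in>\<Phi>. \<psi> (g \<Phi>) = 0) \<and> \<bar>\<phi> (g \<Phi>)\<bar> \<ge> \<epsilon>"
    by metis
  define h where "h \<Phi> = (if finite \<Phi> \<and> \<Phi> \<subseteq> Y then g \<Phi> else 0)" for \<Phi>
  let ?G = "finite_subsets_at_top Y"
  \<comment> \<open>The cluster point is taken for the larger \<open>Z\<close>, so that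
    \<open>\<phi>\<close> and all of \<open>Y\<close> converge along the same filter.\<close>
  obtain G' x where G': "G' \<le> ?G" "G' \<noteq> bot" and lim: "Z.weak_tendsto h x G'"
    by (rule Z.bounded_weak_cluster[of ?G h 1]) (use g in \<open>auto simp: h_def\<close>)
  have x: "x \<in> X" using lim by (simp add: Z.weak_tendsto_def)
  have "\<psi> x = 0" if "\<psi> \<in> Y" for \<psi>
  proof -
    have "\<forall>\<^sub>F \<Phi> in ?G. \<psi> (h \<Phi>) = 0"
      unfolding eventually_finite_subsets_at_top
      using that g by (intro exI[of _ "{\<psi>}"]) (auto simp: h_def)
    then have "((\<lambda>\<Phi>. \<psi> (h \<Phi>)) \<longlongrightarrow> 0) G'"
      using G'(1) by (intro tendsto_eventually) (auto simp: le_filter_def)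
    moreover have "((\<lambda>\<Phi>. \<psi> (h \<Phi>)) \<longlongrightarrow> \<psi> x) G'"
      using lim that assms(3) by (auto simp: Z.weak_tendsto_def)
    ultimately show ?thesis using G'(2) tendsto_unique by blast
  qed
  then have "x = 0" using Y.predual_separates x by blast
  have "\<forall>\<^sub>F \<Phi> in ?G. \<bar>\<phi> (h \<Phi>)\<bar> \<ge> \<epsilon>"
    using g by (auto simp: eventually_finite_subsets_at_top h_def intro!: exI[of _ "{}"])
  then have "\<forall>\<^sub>F \<Phi> in G'. \<bar>\<phi> (h \<Phi>)\<bar> \<ge> \<epsilon>" using G'(1) by (auto simp: le_filter_def)
  moreover have "((\<lambda>\<Phi>. \<bar>\<phi> (h \<Phi>)\<bar>) \<longlongrightarrow> \<bar>\<phi> x\<bar>) G'"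
    using lim \<phi>(1) by (auto simp: Z.weak_tendsto_def intro!: tendsto_rabs)
  ultimately have "\<epsilon> \<le> \<bar>\<phi> x\<bar>" using G'(2) tendsto_lowerbound by blast
  then show False
    using \<epsilon>(1) \<open>x = 0\<close> Y.dual_spaceD(4)[OF Z.predual_dual[OF \<phi>(1)]] by simp
qed

section \<open>Norm-closed spans and a criterion for preduals\<close>

context normed_carrier
begin

text \<open>The norm closure of the span in the dual. The estimate is spelled out pointwise, the
  form in which \<open>approx_by_span_of_finite\<close> delivers it.\<close>

definition dual_closure :: "('v \<Rightarrow> real) set \<Rightarrow> ('v \<Rightarrow> real) set"
  where "dual_closure S =
    {\<phi> \<in> dual_space X N. \<forall>\<epsilon>>0. \<exists>y\<in>span S. \<forall>x\<in>X. \<bar>\<phi> x - y x\<bar> \<le> \<epsilon> * N x}"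

lemma subspace_dual_closure: "subspace (dual_closure S)"
  unfolding subspace_def
proof (intro conjI ballI allI)
  show "0 \<in> dual_closure S"
    by (auto simp: dual_closure_def subspace_0[OF subspace_dual_space] intro!: bexI[of _ 0] span_zero)
  show "\<phi> + \<psi> \<in> dual_closure S"
    if \<phi>: "\<phi> \<in> dual_closure S" and \<psi>: "\<psi> \<in> dual_closure S" for \<phi> \<psi>
    unfolding dual_closure_def
  proof (intro CollectI conjI allI impI)
    show "\<phi> + \<psi> \<in> dual_space X N" using that by (simp add: dual_closure_def dual_space_add)
    fix \<epsilon> :: real assume "\<epsilon> > 0"
    then have half: "\<epsilon> / 2 > 0" by simp
    obtain y where y: "y \<in> span S" "\<And>x. x \<in> X \<Longrightarrow> \<bar>\<phi> x - y x\<bar> \<le> \<epsilon> / 2 * N x"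
      using \<phi> half unfolding dual_closure_def by blast
    obtain z where z: "z \<in> span S" "\<And>x. x \<in> X \<Longrightarrow> \<bar>\<psi> x - z x\<bar> \<le> \<epsilon> / 2 * N x"
      using \<psi> half unfolding dual_closure_def by blast
    have "\<bar>(\<phi> + \<psi>) x - (y + z) x\<bar> \<le> \<epsilon> * N x" if "x \<in> X" for x
      using y(2)[OF that] z(2)[OF that] unfolding plus_fun_apply by linarith
    then show "\<exists>y\<in>span S. \<forall>x\<in>X. \<bar>(\<phi> + \<psi>) x - y x\<bar> \<le> \<epsilon> * N x"
      using y(1) z(1) by (intro bexI[of _ "y + z"] span_add) auto
  qed
  show "c *\<^sub>R \<phi> \<in> dual_closure S" if \<phi>: "\<phi> \<in> dual_closure S" for c \<phi>
    unfolding dual_closure_def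
  proof (intro CollectI conjI allI impI)
    show "c *\<^sub>R \<phi> \<in> dual_space X N" using that by (simp add: dual_closure_def dual_space_scale)
    fix \<epsilon> :: real assume \<epsilon>: "\<epsilon> > 0"
    then have "\<epsilon> / (\<bar>c\<bar> + 1) > 0" by simp
    then obtain y where y: "y \<in> span S" "\<forall>x\<in>X. \<bar>\<phi> x - y x\<bar> \<le> \<epsilon> / (\<bar>c\<bar> + 1) * N x"
      using \<phi> unfolding dual_closure_def by blast
    have "\<bar>(c *\<^sub>R \<phi>) x - (c *\<^sub>R y) x\<bar> \<le> \<epsilon> * N x" if "x \<in> X" for x
    proof -
      have "\<bar>(c *\<^sub>R \<phi>) x - (c *\<^sub>R y) x\<bar> = \<bar>c\<bar> * \<bar>\<phi> x - y x\<bar>"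
        by (simp add: abs_mult[symmetric] algebra_simps)
      also have "\<dots> \<le> (\<bar>c\<bar> + 1) * (\<epsilon> / (\<bar>c\<bar> + 1) * N x)"
        using y(2) that by (intro mult_mono) auto
      finally show ?thesis by simp
    qed
    then show "\<exists>y\<in>span S. \<forall>x\<in>X. \<bar>(c *\<^sub>R \<phi>) x - y x\<bar> \<le> \<epsilon> * N x"
      using y(1) by (intro bexI[of _ "c *\<^sub>R y"] span_scale) auto
  qed
qed

lemma closed_subspace_dual_closure:
  "closed_subspace_of (dual_space X N) (dual_norm X N) (dual_closure S)"
  unfolding closed_subspace_of_def
proof (intro conjI ballI subspace_dual_closure)
  show "dual_closure S \<subseteq> dual_space X N" by (auto simp: dual_closure_def)
  fix \<phi> assume "\<phi> \<in> dual_space X N - dual_closure S"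
  then obtain \<epsilon> where \<phi>: "\<phi> \<in> dual_space X N" and \<epsilon>: "\<epsilon> > 0"
    "\<And>y. y \<in> span S \<Longrightarrow> \<exists>x\<in>X. \<not> \<bar>\<phi> x - y x\<bar> \<le> \<epsilon> * N x"
    unfolding dual_closure_def by blast
  have "\<psi> \<notin> dual_closure S"
    if \<psi>: "\<psi> \<in> dual_space X N" "dual_norm X N (\<psi> - \<phi>) < \<epsilon> / 2" for \<psi>
  proof
    assume "\<psi> \<in> dual_closure S"
    moreover have "\<epsilon> / 2 > 0" using \<epsilon>(1) by simp
    ultimately obtain y where y: "y \<in> span S" "\<And>x. x \<in> X \<Longrightarrow> \<bar>\<psi> x - y x\<bar> \<le> \<epsilon> / 2 * N x"
      unfolding dual_closure_def by blast
    obtain x where x: "x \<in> X" "\<not> \<bar>\<phi> x - y x\<bar> \<le> \<epsilon> * N x" using \<epsilon>(2)[OF y(1)] by blast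
    have "\<bar>\<psi> x - \<phi> x\<bar> \<le> dual_norm X N (\<psi> - \<phi>) * N x"
      using dual_norm_bound[OF subspace_diff[OF subspace_dual_space \<psi>(1) \<phi>] x(1)] by simp
    also have "\<dots> \<le> \<epsilon> / 2 * N x" using \<psi>(2) x(1) by (intro mult_right_mono) auto
    finally show False using y(2)[OF x(1)] x(2) by linarith
  qed
  then show "\<exists>\<epsilon>>0. \<forall>z\<in>dual_space X N. dual_norm X N (z - \<phi>) < \<epsilon> \<longrightarrow> z \<notin> dual_closure S"
    using \<epsilon>(1) by (intro exI[of _ "\<epsilon> / 2"]) auto
qed

text \<open>For every subspace of the dual, evaluations are bounded functionals of norm at most
  \<open>N x\<close>; what characterises a closed one as a predual is that it is norming and that
  every functional on it is an evaluation.\<close>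

lemma is_predualI:
  assumes closed: "closed_subspace_of (dual_space X N) (dual_norm X N) Y"
    and norming: "\<And>x C. x \<in> X \<Longrightarrow> 0 \<le> C \<Longrightarrow> (\<And>\<psi>. \<psi> \<in> Y \<Longrightarrow> \<bar>\<psi> x\<bar> \<le> C * dual_norm X N \<psi>) \<Longrightarrow> N x \<le> C"
    and onto: "\<And>\<Lambda>. \<Lambda> \<in> dual_space Y (dual_norm X N) \<Longrightarrow> \<exists>x\<in>X. \<forall>\<psi>\<in>Y. \<psi> x = \<Lambda> \<psi>"
  shows "is_predual X N Y"
proof -
  have Y: "subspace Y" "Y \<subseteq> dual_space X N" using closed by (auto simp: closed_subspace_of_def)
  interpret dual: normed_carrier Y "dual_norm X N"
    using normed_carrier_dual[OF Y] .
  have D: "\<psi> \<in> dual_space X N" if "\<psi> \<in> Y" for \<psi> using that Y by auto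
  have le: "\<bar>evaluation Y x \<psi>\<bar> \<le> N x * dual_norm X N \<psi>" if "x \<in> X" "\<psi> \<in> Y" for x \<psi>
    using dual_norm_bound[OF D[OF that(2)] that(1)] that by (simp add: evaluation_def mult.commute)
  have ev: "evaluation Y x \<in> dual_space Y (dual_norm X N)" if "x \<in> X" for x
    using le[OF that] by (intro dual.dual_spaceI[where C = "N x"]) (auto simp: evaluation_def)
  have "linear_on_carrier X (evaluation Y)"
    by (auto simp: linear_on_carrier_def evaluation_def fun_eq_iff D dual_spaceD)
  moreover have "dual_norm Y (dual_norm X N) (evaluation Y x) = N x" if x: "x \<in> X" for x
  proof (rule antisym)
    show "dual_norm Y (dual_norm X N) (evaluation Y x) \<le> N x"
      using le[OF x] x by (intro dual.dual_norm_le) auto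
    show "N x \<le> dual_norm Y (dual_norm X N) (evaluation Y x)"
    proof (rule norming[OF x])
      fix \<psi> assume \<psi>: "\<psi> \<in> Y"
      show "\<bar>\<psi> x\<bar> \<le> dual_norm Y (dual_norm X N) (evaluation Y x) * dual_norm X N \<psi>"
        using dual.dual_norm_bound[OF ev[OF x] \<psi>] \<psi> by (simp add: evaluation_def)
    qed (use dual.dual_norm_nonneg ev x in auto)
  qed
  moreover have "evaluation Y ` X = dual_space Y (dual_norm X N)"
  proof
    show "evaluation Y ` X \<subseteq> dual_space Y (dual_norm X N)" using ev by auto
    show "dual_space Y (dual_norm X N) \<subseteq> evaluation Y ` X"
    proof
      fix \<Lambda> assume \<Lambda>: "\<Lambda> \<in> dual_space Y (dual_norm X N)"
      then obtain x where x: "x \<in> X" "\<forall>\<psi>\<in>Y. \<psi> x = \<Lambda> \<psi>" using onto by blast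
      then have "\<Lambda> = evaluation Y x"
        using dual.dual_spaceD(5)[OF \<Lambda>] by (auto simp: evaluation_def fun_eq_iff)
      then show "\<Lambda> \<in> evaluation Y ` X" using x(1) by blast
    qed
  qed
  ultimately show ?thesis using closed by (simp add: is_predual_def)
qed

end

section \<open>The Lipschitz-free space\<close>

text \<open>The one-sided bound suffices because \<open>x\<close> and \<open>y\<close> may be
  exchanged; it matches the one-sided quotients in \<open>lip_norm\<close>.\<close>

lemma Lip0I:
  assumes "\<And>x y. x \<in> M \<Longrightarrow> y \<in> M \<Longrightarrow> f x - f y \<le> C * dist x y" "0 \<le> C"
    and "f p = 0" "\<And>x. x \<notin> M \<Longrightarrow> f x = 0"
  shows "f \<in> Lip0 M p"
proof -
  have "C-lipschitz_on M f"
  proof (rule lipschitz_onI)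
    fix x y assume "x \<in> M" "y \<in> M"
    then show "dist (f x) (f y) \<le> C * dist x y"
      using assms(1)[of x y] assms(1)[of y x] by (simp add: dist_real_def dist_commute abs_le_iff)
  qed fact
  then show ?thesis using assms by (auto simp: Lip0_def)
qed

lemma lip_norm_le:
  assumes "\<And>x y. x \<in> M \<Longrightarrow> y \<in> M \<Longrightarrow> f x - f y \<le> C * dist x y" "0 \<le> C"
  shows "lip_norm M f \<le> C"
  unfolding lip_norm_def using assms by (intro cSup_least) (auto simp: divide_le_eq)

lemma lip_norm_nonneg_bound:
  assumes "f \<in> Lip0 M p"
  shows lip_norm_nonneg: "0 \<le> lip_norm M f"
    and lip_norm_bound: "x \<in> M \<Longrightarrow> y \<in> M \<Longrightarrow> f x - f y \<le> lip_norm M f * dist x y"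
proof -
  obtain L where L: "L-lipschitz_on M f" using assms by (auto simp: Lip0_def)
  have "f x - f y \<le> L * dist x y" if "x \<in> M" "y \<in> M" for x y
    using lipschitz_onD[OF L that] by (auto simp: dist_real_def)
  then have bdd: "bdd_above (insert 0 {(f x - f y) / dist x y | x y. x \<in> M \<and> y \<in> M \<and> x \<noteq> y})"
    using lipschitz_on_nonneg[OF L] by (intro bdd_aboveI[of _ L]) (auto simp: divide_le_eq)
  show "0 \<le> lip_norm M f" unfolding lip_norm_def using bdd by (intro cSup_upper) auto
  show "f x - f y \<le> lip_norm M f * dist x y" if "x \<in> M" "y \<in> M" for x y
  proof (cases "x = y")
    case False
    then have "(f x - f y) / dist x y \<le> lip_norm M f"
      unfolding lip_norm_def using that bdd by (intro cSup_upper) auto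
    then show ?thesis using False by (simp add: divide_le_eq)
  qed simp
qed

lemma lip_norm_abs_bound:
  assumes "f \<in> Lip0 M p" "x \<in> M" "y \<in> M"
  shows "\<bar>f x - f y\<bar> \<le> lip_norm M f * dist x y"
  using lip_norm_bound[OF assms] lip_norm_bound[OF assms(1,3,2)] by (simp add: dist_commute abs_le_iff)

lemma Lip0D:
  assumes "f \<in> Lip0 M p"
  shows "f p = 0" "x \<notin> M \<Longrightarrow> f x = 0"
  using assms by (auto simp: Lip0_def)

lemma normed_carrier_Lip0:
  assumes "p \<in> M"
  shows "normed_carrier (Lip0 M p) (lip_norm M)"
proof
  have add_bound: "(f + g) x - (f + g) y \<le> (lip_norm M f + lip_norm M g) * dist x y"
    if "f \<in> Lip0 M p" "g \<in> Lip0 M p" "x \<in> M" "y \<in> M" for f g x y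
    using lip_norm_bound[OF that(1,3,4)] lip_norm_bound[OF that(2,3,4)] by (simp add: algebra_simps)
  have scale_bound: "(c *\<^sub>R f) x - (c *\<^sub>R f) y \<le> (\<bar>c\<bar> * lip_norm M f) * dist x y"
    if "f \<in> Lip0 M p" "x \<in> M" "y \<in> M" for c f x y
  proof -
    have "(c *\<^sub>R f) x - (c *\<^sub>R f) y = c * (f x - f y)" by (simp add: algebra_simps)
    also have "\<dots> \<le> \<bar>c\<bar> * \<bar>f x - f y\<bar>" by (metis abs_ge_self abs_mult)
    also have "\<dots> \<le> \<bar>c\<bar> * (lip_norm M f * dist x y)"
      using lip_norm_abs_bound[OF that] by (intro mult_left_mono) auto
    finally show ?thesis by (simp add: mult.assoc)
  qed
  show "subspace (Lip0 M p)"
    unfolding subspace_def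
  proof (intro conjI ballI allI)
    show "0 \<in> Lip0 M p" by (rule Lip0I[where C = 0]) auto
    show "f + g \<in> Lip0 M p" if "f \<in> Lip0 M p" "g \<in> Lip0 M p" for f g
      using that add_bound[OF that]
      by (intro Lip0I[where C = "lip_norm M f + lip_norm M g"])
        (auto simp: lip_norm_nonneg Lip0D intro!: add_nonneg_nonneg dest: lip_norm_nonneg)
    show "c *\<^sub>R f \<in> Lip0 M p" if "f \<in> Lip0 M p" for c f
      using that scale_bound[OF that]
      by (intro Lip0I[where C = "\<bar>c\<bar> * lip_norm M f"]) (auto simp: Lip0D dest: lip_norm_nonneg)
  qed
  show "lip_norm M (f + g) \<le> lip_norm M f + lip_norm M g" if "f \<in> Lip0 M p" "g \<in> Lip0 M p" for f g
    using that add_bound[OF that] by (intro lip_norm_le) (auto intro!: add_nonneg_nonneg dest: lip_norm_nonneg)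
  have le: "lip_norm M (c *\<^sub>R f) \<le> \<bar>c\<bar> * lip_norm M f" if "f \<in> Lip0 M p" for c f
    using that scale_bound[OF that] by (intro lip_norm_le) (auto dest: lip_norm_nonneg)
  show "lip_norm M (c *\<^sub>R f) = \<bar>c\<bar> * lip_norm M f" if "f \<in> Lip0 M p" for c f
  proof (cases "c = 0")
    case True
    then show ?thesis
      using le[OF that, of 0] lip_norm_nonneg[OF subspace_0[OF \<open>subspace (Lip0 M p)\<close>]] by simp
  next
    case False
    have "lip_norm M f = lip_norm M ((1 / c) *\<^sub>R (c *\<^sub>R f))" using False by simp
    also have "\<dots> \<le> \<bar>1 / c\<bar> * lip_norm M (c *\<^sub>R f)"
      using that \<open>subspace (Lip0 M p)\<close> by (intro le subspace_scale)
    finally have "\<bar>c\<bar> * lip_norm M f \<le> lip_norm M (c *\<^sub>R f)"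
      using False by (simp add: field_simps)
    then show ?thesis using le[OF that, of c] by simp
  qed
  show "f = 0" if "f \<in> Lip0 M p" "lip_norm M f = 0" for f
  proof
    fix x show "f x = 0 x"
      using lip_norm_abs_bound[OF that(1) _ assms, of x] that Lip0D[OF that(1)] by (cases "x \<in> M") auto
  qed
qed

definition point_evaluation :: "'a::metric_space set \<Rightarrow> 'a \<Rightarrow> 'a \<Rightarrow> ('a \<Rightarrow> real) \<Rightarrow> real"
  where "point_evaluation M p x = (\<lambda>f. if f \<in> Lip0 M p then f x else 0)"

lemma point_evaluation_in_dual:
  assumes "p \<in> M" "x \<in> M"
  shows "point_evaluation M p x \<in> dual_space (Lip0 M p) (lip_norm M)"
proof -
  interpret normed_carrier "Lip0 M p" "lip_norm M" by (rule normed_carrier_Lip0[OF assms(1)])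
  show ?thesis
  proof (rule dual_spaceI[where C = "dist x p"])
    show "\<bar>point_evaluation M p x f\<bar> \<le> dist x p * lip_norm M f" if "f \<in> Lip0 M p" for f
      using lip_norm_abs_bound[OF that assms(2,1)] Lip0D(1)[OF that] that
      by (simp add: point_evaluation_def mult.commute)
  qed (auto simp: point_evaluation_def)
qed

definition lipschitz_free :: "'a::metric_space set \<Rightarrow> 'a \<Rightarrow> (('a \<Rightarrow> real) \<Rightarrow> real) set"
  where "lipschitz_free M p =
    normed_carrier.dual_closure (Lip0 M p) (lip_norm M) (point_evaluation M p ` M)"

text \<open>Norming: differences of two point evaluations have norm at most the distance of the
  points, so they detect the Lipschitz constant. Surjectivity: \<open>\<Lambda>\<close> is
  evaluation at the function sending \<open>x\<close> to the value of \<open>\<Lambda>\<close> at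
  the point evaluation of \<open>x\<close>, first on the span and then by density.\<close>

lemma is_predual_lipschitz_free:
  assumes p: "p \<in> M"
  shows "is_predual (Lip0 M p) (lip_norm M) (lipschitz_free M p)"
proof -
  interpret normed_carrier "Lip0 M p" "lip_norm M" by (rule normed_carrier_Lip0[OF p])
  let ?\<delta> = "point_evaluation M p" and ?D = "dual_space (Lip0 M p) (lip_norm M)"
    and ?n = "dual_norm (Lip0 M p) (lip_norm M)"
  have \<delta>: "?\<delta> x \<in> ?D" if "x \<in> M" for x
    by (rule point_evaluation_in_dual[OF p that])
  have span_D: "span (?\<delta> ` M) \<subseteq> ?D"
    using \<delta> subspace_dual_space by (intro span_minimal) auto
  have span_free: "y \<in> lipschitz_free M p" if "y \<in> span (?\<delta> ` M)" for y
    using that span_D by (auto simp: lipschitz_free_def dual_closure_def intro!: bexI[of _ y])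
  have closed: "closed_subspace_of ?D ?n (lipschitz_free M p)"
    unfolding lipschitz_free_def by (rule closed_subspace_dual_closure)
  have D: "\<psi> \<in> ?D" if "\<psi> \<in> lipschitz_free M p" for \<psi>
    using that closed by (auto simp: closed_subspace_of_def)
  have sub: "subspace (lipschitz_free M p)" using closed by (auto simp: closed_subspace_of_def)
  interpret dual: normed_carrier "lipschitz_free M p" ?n
    using normed_carrier_dual[OF sub] D by auto
  have molecule: "?n (?\<delta> x - ?\<delta> y) \<le> dist x y" if "x \<in> M" "y \<in> M" for x y
  proof (rule dual_norm_le)
    show "\<bar>(?\<delta> x - ?\<delta> y) f\<bar> \<le> dist x y * lip_norm M f" if "f \<in> Lip0 M p" for f
      using lip_norm_abs_bound[OF that \<open>x \<in> M\<close> \<open>y \<in> M\<close>] that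
      by (simp add: point_evaluation_def mult.commute)
  qed simp
  have mol_free: "?\<delta> x - ?\<delta> y \<in> lipschitz_free M p" if "x \<in> M" "y \<in> M" for x y
    using that by (intro span_free span_diff span_base) auto
  show ?thesis
  proof (rule is_predualI[OF closed])
    fix f C assume f: "f \<in> Lip0 M p" and C: "0 \<le> C"
      and le: "\<And>\<psi>. \<psi> \<in> lipschitz_free M p \<Longrightarrow> \<bar>\<psi> f\<bar> \<le> C * ?n \<psi>"
    show "lip_norm M f \<le> C"
    proof (rule lip_norm_le[OF _ C])
      fix x y assume xy: "x \<in> M" "y \<in> M"
      have "f x - f y \<le> \<bar>(?\<delta> x - ?\<delta> y) f\<bar>" using f by (simp add: point_evaluation_def)
      also have "\<dots> \<le> C * ?n (?\<delta> x - ?\<delta> y)" using le mol_free xy by blast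
      also have "\<dots> \<le> C * dist x y" using molecule[OF xy] C by (intro mult_left_mono)
      finally show "f x - f y \<le> C * dist x y" .
    qed
  next
    fix \<Lambda> assume \<Lambda>: "\<Lambda> \<in> dual_space (lipschitz_free M p) ?n"
    define C where "C = dual_norm (lipschitz_free M p) ?n \<Lambda>"
    have C: "0 \<le> C" "\<And>\<psi>. \<psi> \<in> lipschitz_free M p \<Longrightarrow> \<bar>\<Lambda> \<psi>\<bar> \<le> C * ?n \<psi>"
      using dual.dual_norm_nonneg[OF \<Lambda>] dual.dual_norm_bound[OF \<Lambda>] by (auto simp: C_def)
    define f where "f x = (if x \<in> M then \<Lambda> (?\<delta> x) else 0)" for x
    have \<delta>_free: "?\<delta> x \<in> lipschitz_free M p" if "x \<in> M" for x
      using that by (intro span_free span_base) auto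
    have f: "f \<in> Lip0 M p"
    proof (rule Lip0I[OF _ C(1)])
      fix x y assume xy: "x \<in> M" "y \<in> M"
      have "f x - f y = \<Lambda> (?\<delta> x - ?\<delta> y)"
        using xy by (simp add: f_def dual.dual_spaceD[OF \<Lambda>] \<delta>_free)
      also have "\<dots> \<le> C * ?n (?\<delta> x - ?\<delta> y)" using C(2)[OF mol_free[OF xy]] by simp
      also have "\<dots> \<le> C * dist x y" using molecule[OF xy] C by (intro mult_left_mono)
      finally show "f x - f y \<le> C * dist x y" .
    next
      have "?\<delta> p = 0" by (rule ext) (auto simp: point_evaluation_def Lip0D)
      then have "f p = \<Lambda> 0" using p by (simp only: f_def if_True)
      then show "f p = 0" using dual.dual_spaceD(4)[OF \<Lambda>] by simp
    qed (simp add: f_def)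
    \<comment> \<open>Membership is carried through the induction because \<open>\<Lambda>\<close>
      is linear on its carrier only.\<close>
    have "y \<in> lipschitz_free M p \<and> \<Lambda> y = y f" if "y \<in> span (?\<delta> ` M)" for y
      using that
    proof (induction rule: span_induct_alt)
      case base
      show ?case
        using dual.dual_spaceD(4)[OF \<Lambda>] dual.carrier_closed(1) by (simp add: zero_fun_def)
    next
      case (step c y z)
      then obtain x where x: "x \<in> M" "y = ?\<delta> x" by auto
      have "y f = f x" using x f by (simp add: point_evaluation_def)
      also have "\<dots> = \<Lambda> y" using x by (simp add: f_def)
      finally have "c *\<^sub>R y + z \<in> lipschitz_free M p \<and> \<Lambda> (c *\<^sub>R y + z) = (c *\<^sub>R y + z) f"
        using step.IH \<delta>_free[OF x(1)] by (auto simp: dual.dual_spaceD[OF \<Lambda>] x(2))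
      then show ?case by (simp add: plus_fun_def scaleR_fun_def)
    qed
    then have on_span: "\<Lambda> y = y f" if "y \<in> span (?\<delta> ` M)" for y using that by blast
    have "\<psi> f = \<Lambda> \<psi>" if \<psi>: "\<psi> \<in> lipschitz_free M p" for \<psi>
    proof -
      have "\<bar>\<psi> f - \<Lambda> \<psi>\<bar> \<le> 0 + \<epsilon>" if \<epsilon>: "\<epsilon> > 0" for \<epsilon>
      proof -
        \<comment> \<open>Replacing \<open>\<psi>\<close> by \<open>y\<close> causes an error at
          \<open>f\<close> and an error under \<open>\<Lambda>\<close>; \<open>k\<close> adds up
          both constants, and \<open>k + 1\<close> is safe as a denominator.\<close>
        define k where "k = lip_norm M f + C"
        have k: "k \<ge> 0" using C(1) lip_norm_nonneg[OF f] by (simp add: k_def)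
        then have "\<epsilon> / (k + 1) > 0" using \<epsilon> by simp
        then obtain y where y: "y \<in> span (?\<delta> ` M)"
          "\<And>g. g \<in> Lip0 M p \<Longrightarrow> \<bar>\<psi> g - y g\<bar> \<le> \<epsilon> / (k + 1) * lip_norm M g"
          using \<psi> unfolding lipschitz_free_def dual_closure_def by blast
        have "?n (\<psi> - y) \<le> \<epsilon> / (k + 1)"
          using y(2) \<epsilon> k by (intro dual_norm_le) auto
        then have "C * ?n (\<psi> - y) \<le> C * (\<epsilon> / (k + 1))" using C(1) by (rule mult_left_mono)
        then have "\<bar>\<Lambda> \<psi> - \<Lambda> y\<bar> \<le> C * (\<epsilon> / (k + 1))"
          using C(2)[of "\<psi> - y"] \<psi> span_free[OF y(1)] by (simp add: dual.dual_spaceD[OF \<Lambda>])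
        then have "\<bar>\<psi> f - \<Lambda> \<psi>\<bar> \<le> \<epsilon> / (k + 1) * lip_norm M f + C * (\<epsilon> / (k + 1))"
          using y(2)[OF f] on_span[OF y(1)] by linarith
        also have "\<dots> = \<epsilon> / (k + 1) * k" by (simp add: k_def algebra_simps add_divide_distrib)
        also have "\<dots> \<le> \<epsilon>" using k \<epsilon> by (simp add: field_simps)
        finally show ?thesis by simp
      qed
      then have "\<bar>\<psi> f - \<Lambda> \<psi>\<bar> \<le> 0" by (rule field_le_epsilon)
      then show ?thesis by simp
    qed
    then show "\<exists>x\<in>Lip0 M p. \<forall>\<psi>\<in>lipschitz_free M p. \<psi> x = \<Lambda> \<psi>" using f by blast
  qed
qed

section \<open>Localisation of weak* limits\<close>

locale lip_predual = predual "Lip0 M p" "lip_norm M" Y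
  for M :: "'a::real_normed_vector set" and p and Y +
  assumes base_in: "p \<in> M"
begin

text \<open>
  The tent \<open>h\<close> has slope \<open>2 * C\<close> between \<open>a\<close> and \<open>b\<close>, but slope at most \<open>C\<close> on pairs of points not
  both in the ball where \<open>g i\<close> is constant. Hence \<open>g i\<close> lies in the balls of radius \<open>2 * C\<close>
  around \<open>h\<close> and \<open>- h\<close>, and so does the limit.
\<close>

lemma weak_limit_locally_constant:
  assumes lim: "weak_tendsto g f G" "G \<noteq> bot"
    and g: "\<And>i. g i \<in> Lip0 M p" "\<And>i. lip_norm M (g i) \<le> C"
    and ab: "a \<in> M" "b \<in> M" "4 * dist a b \<le> \<rho>"
    and const: "\<And>i x. x \<in> M \<Longrightarrow> dist a x < \<rho> \<Longrightarrow> g i x = g i a"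
  shows "f b = f a"
proof -
  define s where "s = dist a b"
  \<comment> \<open>A tent of height \<open>s\<close> and radius \<open>s\<close> around
    \<open>b\<close>; \<open>h\<close> rescales it to slope \<open>2 * C\<close> and shifts it to
    vanish at \<open>p\<close>.\<close>
  define k where "k x = max 0 (s - dist x b)" for x
  define h where "h x = (if x \<in> M then 2 * C * (k x - k p) else 0)" for x
  have C: "0 \<le> C" using g(2)[of undefined] norm_nonneg[OF g(1)[of undefined]] by linarith
  have f: "f \<in> Lip0 M p" using lim(1) by (simp add: weak_tendsto_def)
  have k_lip: "\<bar>k x - k y\<bar> \<le> dist x y" for x y
    using dist_triangle[of x b y] dist_triangle[of y b x] by (auto simp: k_def dist_commute)
  have h_lip: "\<bar>h x - h y\<bar> = 2 * C * \<bar>k x - k y\<bar>" if "x \<in> M" "y \<in> M" for x y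
    using that C by (simp add: h_def right_diff_distrib[symmetric] abs_mult)
  have h: "h \<in> Lip0 M p"
  proof (rule Lip0I[where C = "2 * C"])
    fix x y assume "x \<in> M" "y \<in> M"
    then show "h x - h y \<le> 2 * C * dist x y"
      using h_lip[of x y] mult_left_mono[OF k_lip[of x y], of "2 * C"] C by linarith
  qed (use C base_in in \<open>auto simp: h_def\<close>)
  \<comment> \<open>A point outside the \<open>\<rho>\<close>-ball is at distance at least
    \<open>3 * s\<close> from \<open>b\<close>, hence at least \<open>2 * s\<close> from the support
    of the tent, whose height is only \<open>s\<close>.\<close>
  have far: "\<bar>k x - k y\<bar> \<le> dist x y / 2" if "\<rho> \<le> dist a y" for x y
  proof -
    have "dist a y \<le> dist a b + dist b y" by (rule dist_triangle)
    then have "3 * s \<le> dist b y" using that ab(3) by (simp add: s_def)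
    moreover have "0 \<le> s" by (simp add: s_def)
    ultimately have "k y = 0" by (simp add: k_def dist_commute)
    moreover have "2 * s \<le> dist x y" if "dist x b < s"
      using that dist_triangle[of b y x] \<open>3 * s \<le> dist b y\<close> by (simp add: dist_commute)
    moreover have "\<bar>k x\<bar> \<le> s" if "dist x b < s" using that zero_le_dist[of x b] by (simp add: k_def)
    moreover have "k x = 0" if "\<not> dist x b < s" using that by (simp add: k_def)
    ultimately show ?thesis by (cases "dist x b < s") auto
  qed
  have slope: "\<bar>g i x - g i y\<bar> + \<bar>h x - h y\<bar> \<le> 2 * C * dist x y" if xy: "x \<in> M" "y \<in> M" for i x y
  proof (cases "dist a x < \<rho> \<and> dist a y < \<rho>")
    case True
    then have "g i x = g i y" using const[of x i] const[of y i] xy by auto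
    then show ?thesis
      using h_lip[OF xy] mult_left_mono[OF k_lip[of x y], of "2 * C"] C by simp
  next
    case False
    then have "\<bar>k x - k y\<bar> \<le> dist x y / 2"
      using far[of x y] far[of y x] by (auto simp: abs_minus_commute dist_commute)
    then have "2 * C * \<bar>k x - k y\<bar> \<le> 2 * C * (dist x y / 2)" using C by (intro mult_left_mono) auto
    then have "\<bar>h x - h y\<bar> \<le> C * dist x y" using h_lip[OF xy] by simp
    moreover have "\<bar>g i x - g i y\<bar> \<le> C * dist x y"
      using lip_norm_abs_bound[OF g(1) xy, of i] mult_right_mono[OF g(2)[of i], of "dist x y"] by simp
    ultimately show ?thesis by simp
  qed
  have diff_le: "lip_norm M (f - h) \<le> 2 * C"
  proof (rule weak_tendsto_norm_le[OF lim g(1) h])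
    have "lip_norm M (g i - h) \<le> 2 * C" for i
    proof (rule lip_norm_le)
      fix x y assume "x \<in> M" "y \<in> M"
      from slope[OF this, of i] show "(g i - h) x - (g i - h) y \<le> 2 * C * dist x y" by simp
    qed (use C in simp)
    then show "\<forall>\<^sub>F i in G. lip_norm M (g i - h) \<le> 2 * C" by simp
  qed
  have sum_le: "lip_norm M (f - - h) \<le> 2 * C"
  proof (rule weak_tendsto_norm_le[OF lim g(1)])
    have "lip_norm M (g i - - h) \<le> 2 * C" for i
    proof (rule lip_norm_le)
      fix x y assume "x \<in> M" "y \<in> M"
      from slope[OF this, of i] show "(g i - - h) x - (g i - - h) y \<le> 2 * C * dist x y" by simp
    qed (use C in simp)
    then show "\<forall>\<^sub>F i in G. lip_norm M (g i - - h) \<le> 2 * C" by simp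
  qed (use h in auto)
  \<comment> \<open>From \<open>a\<close> to \<open>b\<close> the tent already uses up the full
    slope \<open>2 * C\<close>, so the bounds for \<open>f - h\<close> and \<open>f - - h\<close>
    leave no room for an increment of \<open>f\<close> of either sign.\<close>
  have hab: "h b - h a = 2 * C * dist a b"
    using ab by (simp add: h_def k_def s_def algebra_simps)
  have "f a - f b + 2 * C * dist a b \<le> 2 * C * dist a b"
    using lip_norm_bound[of "f - h" M p a b] mult_right_mono[OF diff_le, of "dist a b"] f h ab hab
    by simp
  moreover have "f b - f a + 2 * C * dist a b \<le> 2 * C * dist a b"
    using lip_norm_bound[of "f - - h" M p b a] mult_right_mono[OF sum_le, of "dist a b"] f h ab hab
    by (simp add: dist_commute)
  ultimately show ?thesis by simp
qed

text \<open>A derivative-free way to say that the gradient of \<open>f\<close> vanishes inside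
  \<open>U\<close>: connected sets are tested that stay a uniform distance away from the rest of
  \<open>M\<close>.\<close>

definition flat_on :: "('a \<Rightarrow> real) \<Rightarrow> 'a set \<Rightarrow> bool"
  where "flat_on f U \<longleftrightarrow> (\<forall>S \<rho>. connected S \<longrightarrow> S \<subseteq> M \<longrightarrow> 0 < \<rho> \<longrightarrow>
    (\<forall>x\<in>S. \<forall>y\<in>M. dist x y < \<rho> \<longrightarrow> y \<in> U) \<longrightarrow> (\<forall>a\<in>S. \<forall>b\<in>S. f a = f b))"

lemma flat_onD:
  assumes "flat_on f U" "connected S" "S \<subseteq> M" "a \<in> S" "b \<in> S" "0 < \<rho>"
    and "\<And>x y. x \<in> S \<Longrightarrow> y \<in> M \<Longrightarrow> dist x y < \<rho> \<Longrightarrow> y \<in> U"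
  shows "f a = f b"
  using assms unfolding flat_on_def by blast

text \<open>All \<open>g i\<close> vanish on the \<open>\<rho>\<close>-ball around a point of
  \<open>S\<close>, so the limit is constant on the part of \<open>S\<close> within
  \<open>\<rho> / 4\<close> of it; connectedness makes these constants agree.\<close>

lemma weak_limit_flat_on:
  assumes lim: "weak_tendsto g f G" "G \<noteq> bot"
    and g: "\<And>i. g i \<in> Lip0 M p" "\<And>i. lip_norm M (g i) \<le> C"
    and zero: "\<And>i x. x \<in> U \<Longrightarrow> g i x = 0"
  shows "flat_on f U"
  unfolding flat_on_def
proof (intro allI impI ballI)
  fix S \<rho> a b
  assume S: "connected S" "S \<subseteq> M" "0 < \<rho>" "\<forall>x\<in>S. \<forall>y\<in>M. dist x y < \<rho> \<longrightarrow> y \<in> U" "a \<in> S" "b \<in> S"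
  show "f a = f b"
  proof (rule connected_local_const[OF S(1,5,6)], rule ballI)
    fix x assume x: "x \<in> S"
    show "\<forall>\<^sub>F y in at x within S. f x = f y"
      unfolding eventually_at
    proof (intro exI[of _ "\<rho> / 4"] conjI ballI impI)
      fix y assume y: "y \<in> S" "y \<noteq> x \<and> dist y x < \<rho> / 4"
      have "g i z = g i x" if "z \<in> M" "dist x z < \<rho>" for i z
        using S x that zero by (metis dist_self subsetD)
      then show "f x = f y"
        using x y S(2)
        by (intro weak_limit_locally_constant[OF lim g, symmetric, where \<rho> = \<rho>]) (auto simp: dist_commute)
    qed (use S in simp)
  qed
qed

text \<open>Such sequences arise from a functional in \<open>Y\<close> that is not approximable by
  point evaluations on ever finer nets of ever larger balls.\<close>

definition small_sequence :: "(nat \<Rightarrow> 'a \<Rightarrow> real) \<Rightarrow> bool"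
  where "small_sequence f \<longleftrightarrow> (\<forall>n. f n \<in> Lip0 M p \<and> lip_norm M (f n) \<le> 1 \<and>
    (\<forall>x\<in>M. dist x p \<le> real n \<longrightarrow> \<bar>f n x\<bar> \<le> 1 / (real n + 1)))"

text \<open>A discrete product rule. The increment of \<open>\<theta>\<close> is multiplied by the
  value of \<open>f\<close> at a point where \<open>\<theta>\<close> does not vanish, and there
  \<open>f\<close> is at most \<open>\<epsilon>\<close>.\<close>

lemma cutoff_lipschitz:
  assumes f: "f \<in> Lip0 M p" "lip_norm M f \<le> 1"
    and \<theta>: "\<And>x. x \<in> M \<Longrightarrow> 0 \<le> \<theta> x" "\<And>x. x \<in> M \<Longrightarrow> \<theta> x \<le> 1" "0 \<le> K"
      "\<And>x y. x \<in> M \<Longrightarrow> y \<in> M \<Longrightarrow> \<bar>\<theta> x - \<theta> y\<bar> \<le> K * dist x y"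
    and small: "\<And>x. x \<in> M \<Longrightarrow> \<theta> x \<noteq> 0 \<Longrightarrow> \<bar>f x\<bar> \<le> \<epsilon>" "0 \<le> \<epsilon>"
  shows "\<theta> * f \<in> Lip0 M p" "lip_norm M (\<theta> * f) \<le> 1 + K * \<epsilon>"
proof -
  have f1: "\<bar>f x - f y\<bar> \<le> dist x y" if "x \<in> M" "y \<in> M" for x y
    using lip_norm_abs_bound[OF f(1) that] mult_right_mono[OF f(2), of "dist x y"] by simp
  have key: "\<bar>\<theta> x * f x - \<theta> y * f y\<bar> \<le> (1 + K * \<epsilon>) * dist x y"
    if xy: "x \<in> M" "y \<in> M" "\<theta> y \<noteq> 0" for x y
  proof -
    have "\<theta> x * f x - \<theta> y * f y = \<theta> x * (f x - f y) + f y * (\<theta> x - \<theta> y)"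
      by (simp add: algebra_simps)
    also have "\<bar>\<dots>\<bar> \<le> \<theta> x * \<bar>f x - f y\<bar> + \<bar>f y\<bar> * \<bar>\<theta> x - \<theta> y\<bar>"
      using \<theta>(1)[OF xy(1)] by (metis abs_mult abs_of_nonneg abs_triangle_ineq)
    also have "\<dots> \<le> 1 * dist x y + \<epsilon> * (K * dist x y)"
      using \<theta> f1 small xy by (intro add_mono mult_mono) auto
    finally show ?thesis by (simp add: algebra_simps)
  qed
  have le: "(\<theta> * f) x - (\<theta> * f) y \<le> (1 + K * \<epsilon>) * dist x y" if "x \<in> M" "y \<in> M" for x y
    using key[of x y] key[of y x] that \<theta>(3) small(2)
    by (cases "\<theta> x = 0"; cases "\<theta> y = 0") (auto simp: dist_commute abs_minus_commute abs_le_iff)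
  have "0 \<le> 1 + K * \<epsilon>" using \<theta>(3) small(2) by simp
  then show "\<theta> * f \<in> Lip0 M p" "lip_norm M (\<theta> * f) \<le> 1 + K * \<epsilon>"
    using le f(1) by (auto intro!: Lip0I[where C = "1 + K * \<epsilon>"] lip_norm_le simp: Lip0D)
qed

text \<open>
  Multiplying by a cutoff function costs \<open>f n\<close> times the slope of the cutoff, which is
  asymptotically negligible; so gradients of weak limits of small sequences can be localised.
\<close>

lemma cutoff_limit:
  assumes f: "small_sequence f" and lim: "weak_tendsto f F G" "G \<noteq> bot" "G \<le> sequentially"
    and \<theta>: "\<And>x. x \<in> M \<Longrightarrow> 0 \<le> \<theta> x" "\<And>x. x \<in> M \<Longrightarrow> \<theta> x \<le> 1" "0 \<le> K"
      "\<And>x y. x \<in> M \<Longrightarrow> y \<in> M \<Longrightarrow> \<bar>\<theta> x - \<theta> y\<bar> \<le> K * dist x y"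
      "\<And>x. x \<in> M \<Longrightarrow> \<theta> x \<noteq> 0 \<Longrightarrow> dist x p \<le> R" "0 \<le> R"
  obtains G' g where "G' \<le> G" "G' \<noteq> bot" "weak_tendsto (\<lambda>n. \<theta> * f n) g G'" "g \<in> Lip0 M p"
    "lip_norm M g \<le> 2" "\<forall>n. \<theta> * f n \<in> Lip0 M p"
    "\<forall>\<^sub>F n in sequentially. lip_norm M (\<theta> * f n) \<le> 2"
    "flat_on g {x. \<theta> x = 0}" "flat_on (F - g) {x. \<theta> x = 1}"
proof -
  have fX: "f n \<in> Lip0 M p" "lip_norm M (f n) \<le> 1" for n using f by (auto simp: small_sequence_def)
  \<comment> \<open>This crude bound holds for every \<open>n\<close> and gives the boundedness
    needed for a cluster point; the norm bound 2 is reached only eventually.\<close>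
  have fR: "\<bar>f n x\<bar> \<le> R" if "x \<in> M" "\<theta> x \<noteq> 0" for n x
    using lip_norm_abs_bound[OF fX(1) that(1) base_in, of n] mult_mono[OF fX(2)[of n] \<theta>(5)[OF that]]
      Lip0D(1)[OF fX(1)] by simp
  note cut = cutoff_lipschitz[OF fX \<theta>(1-4) fR \<theta>(6)]
  have small: "\<forall>\<^sub>F n in sequentially. lip_norm M (\<theta> * f n) \<le> 2"
  proof (rule eventually_sequentiallyI)
    \<comment> \<open>Beyond \<open>R\<close> the smallness of \<open>f n\<close> covers the support
      of \<open>\<theta>\<close>; beyond \<open>K\<close> the extra term \<open>K / (n + 1)\<close>
      is at most 1.\<close>
    fix n assume "n \<ge> nat \<lceil>max R K\<rceil>"
    then have n: "R \<le> real n" "K \<le> real n" by linarith+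
    have "lip_norm M (\<theta> * f n) \<le> 1 + K * (1 / (real n + 1))"
    proof (rule cutoff_lipschitz[OF fX \<theta>(1-4)])
      fix x assume "x \<in> M" "\<theta> x \<noteq> 0"
      then show "\<bar>f n x\<bar> \<le> 1 / (real n + 1)"
        using \<theta>(5)[of x] n f by (auto simp: small_sequence_def)
    qed auto
    also have "\<dots> \<le> 2" using n(2) by (simp add: field_simps)
    finally show "lip_norm M (\<theta> * f n) \<le> 2" .
  qed
  obtain G' g where G': "G' \<le> G" "G' \<noteq> bot" and g: "weak_tendsto (\<lambda>n. \<theta> * f n) g G'"
    by (rule bounded_weak_cluster[OF lim(2) cut])
  have gX: "g \<in> Lip0 M p" using g by (simp add: weak_tendsto_def)
  have "\<forall>\<^sub>F n in G'. lip_norm M (\<theta> * f n - 0) \<le> 2"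
    using small G'(1) lim(3) by (auto simp: le_filter_def)
  from weak_tendsto_norm_le[OF g G'(2) cut(1) carrier_closed(1) this]
  have "lip_norm M g \<le> 2" by simp
  moreover have "flat_on g {x. \<theta> x = 0}"
    by (rule weak_limit_flat_on[OF g G'(2) cut]) simp_all
  \<comment> \<open>The remainder \<open>f n - \<theta> * f n\<close> vanishes where
    \<open>\<theta>\<close> is 1, and its limit is \<open>F - g\<close>.\<close>
  moreover have "flat_on (F - g) {x. \<theta> x = 1}"
  proof (rule weak_limit_flat_on[OF _ G'(2)])
    show "weak_tendsto (\<lambda>n. f n - \<theta> * f n) (F - g) G'"
      using weak_tendsto_mono[OF lim(1) G'(1)] g fX cut(1) by (intro weak_tendsto_diff)
    show "lip_norm M (f n - \<theta> * f n) \<le> 1 + (1 + K * R)" for n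
      using norm_triangle[of "f n" "- (\<theta> * f n)"] norm_uminus[of "\<theta> * f n"] fX[of n] cut[of n]
        carrier_closed(5)[of "\<theta> * f n"] by simp
  qed (use fX cut in auto)
  ultimately show ?thesis using that[OF G' g gX _ allI small] cut(1) by blast
qed

section \<open>Cutoffs around segments and the case of a set not contained in a line\<close>

definition segment_cutoff :: "'a \<Rightarrow> 'a \<Rightarrow> real \<Rightarrow> 'a \<Rightarrow> real"
  where "segment_cutoff a b \<eta> x = max 0 (min 1 (2 - infdist x (closed_segment a b) / \<eta>))"

lemma segment_cutoff:
  assumes "\<eta> > 0"
  shows segment_cutoff_ge: "0 \<le> segment_cutoff a b \<eta> x"
    and segment_cutoff_le: "segment_cutoff a b \<eta> x \<le> 1"
    and segment_cutoff_lipschitz: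
      "\<bar>segment_cutoff a b \<eta> x - segment_cutoff a b \<eta> y\<bar> \<le> 1 / \<eta> * dist x y"
    and segment_cutoff_eq_1: "u \<in> closed_segment a b \<Longrightarrow> dist u x < \<eta> \<Longrightarrow> segment_cutoff a b \<eta> x = 1"
    and segment_cutoff_eq_0:
      "(\<And>u. u \<in> closed_segment a b \<Longrightarrow> 2 * \<eta> \<le> dist u x) \<Longrightarrow> segment_cutoff a b \<eta> x = 0"
    and segment_cutoff_support:
      "segment_cutoff a b \<eta> x \<noteq> 0 \<Longrightarrow> dist x p \<le> dist a p + dist a b + 2 * \<eta>"
proof -
  let ?S = "closed_segment a b"
  show "0 \<le> segment_cutoff a b \<eta> x" "segment_cutoff a b \<eta> x \<le> 1"
    by (auto simp: segment_cutoff_def)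
  have "\<bar>infdist x ?S - infdist y ?S\<bar> \<le> dist x y"
    using infdist_triangle_abs[of x ?S y] by simp
  then have "\<bar>infdist x ?S / \<eta> - infdist y ?S / \<eta>\<bar> \<le> 1 / \<eta> * dist x y"
    using assms by (simp add: diff_divide_distrib[symmetric] abs_divide divide_right_mono)
  then show "\<bar>segment_cutoff a b \<eta> x - segment_cutoff a b \<eta> y\<bar> \<le> 1 / \<eta> * dist x y"
    by (auto simp: segment_cutoff_def max_def min_def)
  show "segment_cutoff a b \<eta> x = 1" if "u \<in> ?S" "dist u x < \<eta>"
  proof -
    have "infdist x ?S \<le> \<eta>" using infdist_le[OF that(1), of x] that(2) by (simp add: dist_commute)
    then have "infdist x ?S / \<eta> \<le> 1" using assms by (simp add: divide_le_eq)
    then show ?thesis by (simp add: segment_cutoff_def)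
  qed
  show zero: "segment_cutoff a b \<eta> x = 0" if "\<And>u. u \<in> ?S \<Longrightarrow> 2 * \<eta> \<le> dist u x"
  proof -
    have "2 * \<eta> \<le> infdist x ?S"
      unfolding infdist_def using that by (auto simp: dist_commute intro!: cINF_greatest)
    then have "2 \<le> infdist x ?S / \<eta>" using assms by (simp add: le_divide_eq)
    then show ?thesis by (simp add: segment_cutoff_def)
  qed
  show "dist x p \<le> dist a p + dist a b + 2 * \<eta>" if nz: "segment_cutoff a b \<eta> x \<noteq> 0"
  proof -
    obtain u where u: "u \<in> ?S" "dist x u < 2 * \<eta>"
      using zero nz by (metis dist_commute not_le)
    have "dist u a \<le> dist a b"
      using u(1) by (metis dist_commute segment_bound(1) dist_norm)
    then show ?thesis
      using u(2) dist_triangle[of x p u] dist_triangle[of u p a] by linarith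
  qed
qed

text \<open>Moving \<open>a\<close> and \<open>b\<close> by the fraction \<open>t\<close> towards
  \<open>w\<close> gives a parallel segment disjoint from the original one. The cut-off limit
  \<open>g\<close> is constant there, so \<open>g a\<close> and \<open>g b\<close> differ by an
  error of order \<open>t\<close>, as does \<open>F\<close>.\<close>

lemma small_sequence_limit_off_line:
  assumes f: "small_sequence f" and lim: "weak_tendsto f F G" "G \<noteq> bot" "G \<le> sequentially"
    and M: "convex M" and abw: "a \<in> M" "b \<in> M" "w \<in> M" "\<And>s. w \<noteq> a + s *\<^sub>R (b - a)"
  shows "F a = F b"
proof -
  have est: "\<bar>F a - F b\<bar> \<le> 2 * t * (dist a w + dist b w)" if t: "0 < t" "t \<le> 1" for t
  proof -
    define a' where "a' = a + t *\<^sub>R (w - a)"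
    define b' where "b' = b + t *\<^sub>R (w - b)"
    have a'b': "a' \<in> M" "b' \<in> M"
      using convexD_alt[OF M abw(1,3), of t] convexD_alt[OF M abw(2,3), of t] t
      by (auto simp: a'_def b'_def algebra_simps)
    \<comment> \<open>A common point could be solved for \<open>w\<close>, placing it on the line
      through \<open>a\<close> and \<open>b\<close>.\<close>
    have "closed_segment a b \<inter> closed_segment a' b' = {}"
    proof (rule ccontr)
      assume "\<not> ?thesis"
      then obtain x where "x \<in> closed_segment a b" "x \<in> closed_segment a' b'" by blast
      then obtain u v where "(1 - u) *\<^sub>R a + u *\<^sub>R b = (1 - v) *\<^sub>R a' + v *\<^sub>R b'"
        by (auto simp: in_segment)
      then have "t *\<^sub>R w = t *\<^sub>R a + (u - v * (1 - t)) *\<^sub>R (b - a)"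
        by (simp add: a'_def b'_def algebra_simps)
      then have "(1 / t) *\<^sub>R (t *\<^sub>R w) = (1 / t) *\<^sub>R (t *\<^sub>R a + (u - v * (1 - t)) *\<^sub>R (b - a))"
        by simp
      then have "w = a + ((u - v * (1 - t)) / t) *\<^sub>R (b - a)"
        using t by (simp add: scaleR_add_right)
      then show False using abw(4) by blast
    qed
    then have pos: "infdist y (closed_segment a b) > 0" if "y \<in> closed_segment a' b'" for y
      using that by (intro infdist_pos_not_in_closed compact_imp_closed compact_segment) auto
    obtain z where z: "z \<in> closed_segment a' b'"
      "\<And>y. y \<in> closed_segment a' b' \<Longrightarrow>
        infdist z (closed_segment a b) \<le> infdist y (closed_segment a b)"
      using continuous_attains_inf[OF compact_segment[of a' b'] _ continuous_on_infdist[OF continuous_on_id],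
          of "closed_segment a b"] by auto
    define d where "d = infdist z (closed_segment a b)"
    have d: "d > 0" "\<And>x y. x \<in> closed_segment a b \<Longrightarrow> y \<in> closed_segment a' b' \<Longrightarrow> d \<le> dist x y"
    proof -
      show "d > 0" using pos[OF z(1)] by (simp add: d_def)
      show "d \<le> dist x y" if "x \<in> closed_segment a b" "y \<in> closed_segment a' b'" for x y
        using z(2)[OF that(2)] infdist_le[OF that(1), of y] by (simp add: d_def dist_commute)
    qed
    \<comment> \<open>With a third of the distance, points within \<open>\<eta>\<close> of the moved
      segment keep distance \<open>2 * \<eta>\<close> from the original, where the cutoff is
      0.\<close>
    define \<eta> where "\<eta> = d / 3"
    have \<eta>: "\<eta> > 0" using d by (simp add: \<eta>_def)
    have nonneg: "0 \<le> 1 / \<eta>" "0 \<le> dist a p + dist a b + 2 * \<eta>" using \<eta> by auto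
    obtain G' g where "G' \<le> G" "G' \<noteq> bot" "weak_tendsto (\<lambda>n. segment_cutoff a b \<eta> * f n) g G'"
      and g: "g \<in> Lip0 M p" "lip_norm M g \<le> 2"
      and "\<forall>n. segment_cutoff a b \<eta> * f n \<in> Lip0 M p"
        "\<forall>\<^sub>F n in sequentially. lip_norm M (segment_cutoff a b \<eta> * f n) \<le> 2"
      and g01: "flat_on g {x. segment_cutoff a b \<eta> x = 0}" "flat_on (F - g) {x. segment_cutoff a b \<eta> x = 1}"
      by (rule cutoff_limit[OF f lim segment_cutoff_ge[OF \<eta>] segment_cutoff_le[OF \<eta>] nonneg(1)
            segment_cutoff_lipschitz[OF \<eta>] segment_cutoff_support[OF \<eta>] nonneg(2)])
    have "(F - g) a = (F - g) b"
    proof (rule flat_onD[OF g01(2), of "closed_segment a b" a b \<eta>])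
      show "closed_segment a b \<subseteq> M" using M abw by (simp add: closed_segment_subset)
      show "y \<in> {x. segment_cutoff a b \<eta> x = 1}" if "x \<in> closed_segment a b" "dist x y < \<eta>" for x y
        using segment_cutoff_eq_1[OF \<eta> that] by simp
    qed (use \<eta> in auto)
    moreover have "g a' = g b'"
    proof (rule flat_onD[OF g01(1), of "closed_segment a' b'" a' b' \<eta>])
      show "closed_segment a' b' \<subseteq> M" using M a'b' by (simp add: closed_segment_subset)
      show "y \<in> {x. segment_cutoff a b \<eta> x = 0}" if "x \<in> closed_segment a' b'" "dist x y < \<eta>" for x y
      proof (rule CollectI, rule segment_cutoff_eq_0[OF \<eta>])
        fix u assume "u \<in> closed_segment a b"
        then have "3 * \<eta> \<le> dist u x" using d(2) that(1) by (simp add: \<eta>_def)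
        then show "2 * \<eta> \<le> dist u y" using that(2) dist_triangle[of u x y] by (simp add: dist_commute)
      qed
    qed (use \<eta> in auto)
    moreover have "\<bar>g a - g a'\<bar> \<le> 2 * (t * dist a w)"
    proof -
      have "dist a a' = t * dist a w" using t by (simp add: a'_def dist_norm norm_minus_commute)
      then show ?thesis
        using lip_norm_abs_bound[OF g(1) abw(1) a'b'(1)] mult_right_mono[OF g(2) zero_le_dist[of a a']]
        by simp
    qed
    moreover have "\<bar>g b - g b'\<bar> \<le> 2 * (t * dist b w)"
    proof -
      have "dist b b' = t * dist b w" using t by (simp add: b'_def dist_norm norm_minus_commute)
      then show ?thesis
        using lip_norm_abs_bound[OF g(1) abw(2) a'b'(2)] mult_right_mono[OF g(2) zero_le_dist[of b b']]
        by simp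
    qed
    ultimately show ?thesis by (simp add: algebra_simps)
  qed
  define D where "D = 2 * (dist a w + dist b w)"
  have "\<bar>F a - F b\<bar> \<le> 0 + \<epsilon>" if "\<epsilon> > 0" for \<epsilon>
  proof -
    define t where "t = min 1 (\<epsilon> / (D + 1))"
    have "D \<ge> 0" by (simp add: D_def)
    then have t: "0 < t" "t \<le> 1" using that by (auto simp: t_def)
    have "t * D \<le> \<epsilon> / (D + 1) * D" using \<open>D \<ge> 0\<close> by (intro mult_right_mono) (auto simp: t_def)
    also have "\<dots> \<le> \<epsilon>" using \<open>D \<ge> 0\<close> that by (simp add: field_simps)
    finally show ?thesis using est[OF t] by (simp add: D_def algebra_simps)
  qed
  then have "\<bar>F a - F b\<bar> \<le> 0" by (rule field_le_epsilon)
  then show ?thesis by simp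
qed

end

section \<open>Dyadic energies\<close>

definition dyadic_increment :: "(real \<Rightarrow> real) \<Rightarrow> nat \<Rightarrow> nat \<Rightarrow> real"
  where "dyadic_increment F m i = F ((real i + 1) / 2 ^ m) - F (real i / 2 ^ m)"

text \<open>
  The energies increase with \<open>m\<close> to the integral of the squared derivative, which is thus
  available without differentiating Lipschitz functions.
\<close>

definition dyadic_energy :: "(real \<Rightarrow> real) \<Rightarrow> nat \<Rightarrow> real"
  where "dyadic_energy F m = 2 ^ m * (\<Sum>i<2 ^ m. (dyadic_increment F m i)\<^sup>2)"

text \<open>The symmetric bilinear form whose quadratic form is
  \<open>dyadic_energy\<close>.\<close>

definition dyadic_pairing :: "(real \<Rightarrow> real) \<Rightarrow> (real \<Rightarrow> real) \<Rightarrow> nat \<Rightarrow> real"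
  where "dyadic_pairing F K m = 2 ^ m * (\<Sum>i<2 ^ m. dyadic_increment F m i * dyadic_increment K m i)"

lemma dyadic_increment_split:
  "dyadic_increment F m i = dyadic_increment F (Suc m) (2 * i) + dyadic_increment F (Suc m) (2 * i + 1)"
proof -
  have "real (2 * i) / 2 ^ Suc m = real i / 2 ^ m"
    "(real (2 * i + 1) + 1) / 2 ^ Suc m = (real i + 1) / 2 ^ m"
    "real (2 * i) + 1 = real (2 * i + 1)"
    by (simp_all add: field_simps)
  then show ?thesis unfolding dyadic_increment_def by (simp only: diff_add_eq add_diff_eq)
qed

lemma sum_lessThan_double:
  "(\<Sum>i<2 * n. a i) = (\<Sum>i<n. a (2 * i) + a (2 * i + 1))" for a :: "nat \<Rightarrow> real"
  by (induction n) (auto simp: algebra_simps)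

text \<open>Halving an interval writes its increment as a sum of two; the factor 2 in
  \<open>(x + y)\<^sup>2 \<le> 2 * (x\<^sup>2 + y\<^sup>2)\<close> is absorbed by the weight
  \<open>2 ^ m\<close>.\<close>

lemma dyadic_energy_le_Suc: "dyadic_energy F m \<le> dyadic_energy F (Suc m)"
proof -
  have "(dyadic_increment F m i)\<^sup>2 \<le>
      2 * ((dyadic_increment F (Suc m) (2 * i))\<^sup>2 + (dyadic_increment F (Suc m) (2 * i + 1))\<^sup>2)" for i
    using sum_squares_bound[of "dyadic_increment F (Suc m) (2 * i)" "dyadic_increment F (Suc m) (2 * i + 1)"]
    by (simp add: dyadic_increment_split[of F m] power2_sum)
  then have "(\<Sum>i<2 ^ m. (dyadic_increment F m i)\<^sup>2) \<le>
      2 * (\<Sum>i<2 ^ Suc m. (dyadic_increment F (Suc m) i)\<^sup>2)"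
    by (simp add: sum_lessThan_double sum_distrib_left sum_mono)
  then show ?thesis by (simp add: dyadic_energy_def)
qed

lemma dyadic_energy_mono: "m \<le> n \<Longrightarrow> dyadic_energy F m \<le> dyadic_energy F n"
  by (rule lift_Suc_mono_le[of "dyadic_energy F"]) (auto intro: dyadic_energy_le_Suc)

lemma dyadic_energy_nonneg: "0 \<le> dyadic_energy F m"
  by (simp add: dyadic_energy_def sum_nonneg)

lemma dyadic_increment_add_scale:
  "dyadic_increment (\<lambda>s. F s + c * K s) m i = dyadic_increment F m i + c * dyadic_increment K m i"
  by (simp add: dyadic_increment_def algebra_simps)

lemma dyadic_energy_add_scale:
  "dyadic_energy (\<lambda>s. F s + c * K s) m =
    dyadic_energy F m + 2 * c * dyadic_pairing F K m + c\<^sup>2 * dyadic_energy K m"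
proof -
  have "(\<Sum>i<2 ^ m. (dyadic_increment (\<lambda>s. F s + c * K s) m i)\<^sup>2) =
      (\<Sum>i<2 ^ m. (dyadic_increment F m i)\<^sup>2) +
      2 * c * (\<Sum>i<2 ^ m. dyadic_increment F m i * dyadic_increment K m i) +
      c\<^sup>2 * (\<Sum>i<2 ^ m. (dyadic_increment K m i)\<^sup>2)"
    unfolding dyadic_increment_add_scale sum_distrib_left sum.distrib[symmetric]
    by (intro sum.cong) (auto simp: power2_eq_square algebra_simps)
  then show ?thesis by (simp add: dyadic_energy_def dyadic_pairing_def algebra_simps)
qed

lemma dyadic_energy_scale: "dyadic_energy (\<lambda>s. c * K s) m = c\<^sup>2 * dyadic_energy K m"
  using dyadic_energy_add_scale[of "\<lambda>_. 0" c K m]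
  by (simp add: dyadic_energy_def dyadic_pairing_def dyadic_increment_def)

lemma dyadic_points:
  assumes "i < 2 ^ m"
  shows "real i / 2 ^ m \<in> {0..1}" "(real i + 1) / 2 ^ m \<in> {0..1}"
proof -
  have "real i + 1 \<le> 2 ^ m"
    using assms by (metis Suc_leI of_nat_Suc of_nat_le_iff of_nat_numeral of_nat_power add.commute)
  then show "real i / 2 ^ m \<in> {0..1}" "(real i + 1) / 2 ^ m \<in> {0..1}"
    using assms by (auto simp: divide_le_eq)
qed

lemma dyadic_increment_le:
  assumes "A-lipschitz_on {0..1} F" "i < 2 ^ m"
  shows "\<bar>dyadic_increment F m i\<bar> \<le> A / 2 ^ m"
proof -
  have "dist ((real i + 1) / 2 ^ m) (real i / 2 ^ m) = 1 / 2 ^ m"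
    by (simp add: dist_real_def diff_divide_distrib[symmetric])
  then show ?thesis
    using lipschitz_onD[OF assms(1) dyadic_points(2,1)[OF assms(2)]]
    by (simp add: dyadic_increment_def dist_real_def)
qed

lemma dyadic_energy_le:
  assumes "A-lipschitz_on {0..1} F"
  shows "dyadic_energy F m \<le> A\<^sup>2"
proof -
  have "(\<Sum>i<2 ^ m. (dyadic_increment F m i)\<^sup>2) \<le> (\<Sum>i<(2::nat) ^ m. (A / 2 ^ m)\<^sup>2)"
    using dyadic_increment_le[OF assms] lipschitz_on_nonneg[OF assms]
    by (intro sum_mono abs_le_square_iff[THEN iffD1]) auto
  then have "dyadic_energy F m \<le> 2 ^ m * (2 ^ m * (A / 2 ^ m)\<^sup>2)"
    by (simp add: dyadic_energy_def)
  also have "\<dots> = A\<^sup>2" by (simp add: power2_eq_square)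
  finally show ?thesis .
qed

text \<open>Uniform smallness of \<open>K\<close> controls the pairing at a fixed level, but the
  bound deteriorates as \<open>m\<close> grows.\<close>

lemma dyadic_pairing_le:
  assumes "A-lipschitz_on {0..1} F" "\<And>s. s \<in> {0..1} \<Longrightarrow> \<bar>K s\<bar> \<le> \<delta>"
  shows "\<bar>dyadic_pairing F K m\<bar> \<le> 2 ^ m * (2 * A * \<delta>)"
proof -
  have K: "\<bar>dyadic_increment K m i\<bar> \<le> 2 * \<delta>" if "i < 2 ^ m" for i
    using assms(2)[OF dyadic_points(1)[OF that]] assms(2)[OF dyadic_points(2)[OF that]]
    by (simp add: dyadic_increment_def)
  have "\<bar>\<Sum>i<2 ^ m. dyadic_increment F m i * dyadic_increment K m i\<bar> \<le>
      (\<Sum>i<2 ^ m. \<bar>dyadic_increment F m i\<bar> * \<bar>dyadic_increment K m i\<bar>)"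
    using sum_abs[of "\<lambda>i. dyadic_increment F m i * dyadic_increment K m i" "{..<2 ^ m}"]
    by (simp add: abs_mult)
  also have "\<dots> \<le> (\<Sum>i<(2::nat) ^ m. (A / 2 ^ m) * (2 * \<delta>))"
    using dyadic_increment_le[OF assms(1)] K lipschitz_on_nonneg[OF assms(1)]
    by (intro sum_mono mult_mono) auto
  also have "\<dots> = 2 * A * \<delta>" by simp
  finally show ?thesis by (simp add: dyadic_pairing_def abs_mult)
qed

text \<open>
  Past a level \<open>m0\<close> where the energy of \<open>F\<close> is almost exhausted, the monotonicity of the energy of
  \<open>F - \<tau> * K\<close> bounds the pairing of \<open>F\<close> and \<open>K\<close> by its value at level \<open>m0\<close>, which is small.
\<close>

lemma dyadic_energy_add_small:
  assumes F: "A'-lipschitz_on {0..1} F" "\<And>m. dyadic_energy F m \<le> E"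
  obtains \<delta> where "\<delta> > 0" "\<And>K m. A-lipschitz_on {0..1} K \<Longrightarrow> (\<And>s. s \<in> {0..1} \<Longrightarrow> \<bar>K s\<bar> \<le> \<delta>) \<Longrightarrow>
    dyadic_energy (\<lambda>s. F s + K s) m \<le> E + A\<^sup>2 + 1"
proof -
  \<comment> \<open>Chosen so that \<open>\<tau>\<^sup>2 * (1 + A\<^sup>2)\<close> equals
    \<open>\<tau> / 2\<close>, which after division by \<open>\<tau>\<close> bounds twice the growth
    of the pairing by 1/2.\<close>
  define \<tau> where "\<tau> = 1 / (2 * (1 + A\<^sup>2))"
  have "1 + A\<^sup>2 > 0" by (smt (verit) zero_le_power2)
  then have \<tau>: "\<tau> > 0" "\<tau> * (1 + A\<^sup>2) = 1 / 2" by (auto simp: \<tau>_def)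
  have A': "A' \<ge> 0" using lipschitz_on_nonneg[OF F(1)] .
  obtain L where L: "dyadic_energy F \<longlonglongrightarrow> L" "\<And>m. dyadic_energy F m \<le> L"
    using incseq_convergent[of "dyadic_energy F" E] F(2) dyadic_energy_mono
    by (metis incseq_def)
  have "L - \<tau>\<^sup>2 < L" using \<tau> by simp
  then obtain m0 where m0: "L - \<tau>\<^sup>2 < dyadic_energy F m0"
    using order_tendstoD(1)[OF L(1)] eventually_happens by (metis sequentially_bot)
  \<comment> \<open>Small enough for the pairing at the fixed level \<open>m0\<close> to be at most
    1/4.\<close>
  define \<delta> where "\<delta> = 1 / (8 * 2 ^ m0 * (A' + 1))"
  have \<delta>: "\<delta> > 0" using A' by (simp add: \<delta>_def)
  have small: "2 ^ m0 * (2 * A' * \<delta>) \<le> 1 / 4"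
    using A' by (simp add: \<delta>_def divide_le_eq)
  show ?thesis
  proof (rule that[OF \<delta>])
    fix K :: "real \<Rightarrow> real" and m
    assume K: "A-lipschitz_on {0..1} K" "\<And>s. s \<in> {0..1} \<Longrightarrow> \<bar>K s\<bar> \<le> \<delta>"
    \<comment> \<open>The estimate is made at a level past \<open>m0\<close> and returned to
      \<open>m\<close> by monotonicity of the energy.\<close>
    define n where "n = max m m0"
    have n: "m \<le> n" "m0 \<le> n" by (auto simp: n_def)
    have "dyadic_energy (\<lambda>s. F s + (- \<tau>) * K s) m0 \<le> dyadic_energy (\<lambda>s. F s + (- \<tau>) * K s) n"
      using n by (intro dyadic_energy_mono)
    then have "2 * \<tau> * (dyadic_pairing F K n - dyadic_pairing F K m0) \<le>
        (dyadic_energy F n - dyadic_energy F m0) + \<tau>\<^sup>2 * dyadic_energy K n - \<tau>\<^sup>2 * dyadic_energy K m0"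
      unfolding dyadic_energy_add_scale by (simp add: algebra_simps)
    also have "\<dots> \<le> \<tau>\<^sup>2 + \<tau>\<^sup>2 * A\<^sup>2"
    proof -
      have "\<tau>\<^sup>2 * dyadic_energy K n \<le> \<tau>\<^sup>2 * A\<^sup>2"
        by (intro mult_left_mono dyadic_energy_le K) simp
      moreover have "0 \<le> \<tau>\<^sup>2 * dyadic_energy K m0" by (simp add: dyadic_energy_nonneg)
      ultimately show ?thesis using m0 L(2)[of n] by linarith
    qed
    also have "\<dots> = \<tau> * (1 / 2)"
      unfolding \<tau>(2)[symmetric] by (simp add: power2_eq_square algebra_simps)
    finally have "\<tau> * (2 * (dyadic_pairing F K n - dyadic_pairing F K m0)) \<le> \<tau> * (1 / 2)"
      by (simp only: mult.assoc mult.left_commute)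
    then have "2 * (dyadic_pairing F K n - dyadic_pairing F K m0) \<le> 1 / 2"
      using \<tau>(1) mult_le_cancel_left_pos by blast
    moreover have "dyadic_pairing F K m0 \<le> 1 / 4"
      using dyadic_pairing_le[where K = K and m = m0 and \<delta> = \<delta>, OF F(1) K(2)] small by linarith
    ultimately have "2 * dyadic_pairing F K n \<le> 1" by (simp add: algebra_simps)
    moreover have "dyadic_energy (\<lambda>s. F s + K s) n =
        dyadic_energy F n + 2 * dyadic_pairing F K n + dyadic_energy K n"
      using dyadic_energy_add_scale[of F 1 K n] by simp
    moreover have "dyadic_energy (\<lambda>s. F s + K s) m \<le> dyadic_energy (\<lambda>s. F s + K s) n"
      using n by (intro dyadic_energy_mono)
    ultimately show "dyadic_energy (\<lambda>s. F s + K s) m \<le> E + A\<^sup>2 + 1"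
      using F(2)[of n] dyadic_energy_le[OF K(1), of n] by linarith
  qed
qed

text \<open>
  The function \<open>H\<close> is the integral of the supremum over \<open>k\<close> of the absolute derivatives of \<open>G k\<close>;
  its total increment is estimated by \<open>\<bar>x\<bar> \<le> c + x\<^sup>2 / c\<close>.
\<close>

lemma dominating_function:
  fixes G :: "nat \<Rightarrow> real \<Rightarrow> real"
  assumes G: "\<And>k. A-lipschitz_on {0..1} (G k)" and \<tau>: "\<tau> > 0"
    and E: "\<And>k m. dyadic_energy (G k) m \<le> \<tau>\<^sup>2 / 4 ^ k"
  obtains H where
    "\<And>k s t. 0 \<le> s \<Longrightarrow> s \<le> t \<Longrightarrow> t \<le> 1 \<Longrightarrow> \<bar>G k t - G k s\<bar> \<le> H t - H s"
    "\<And>s t. 0 \<le> s \<Longrightarrow> s \<le> t \<Longrightarrow> t \<le> 1 \<Longrightarrow> H t - H s \<le> A * (t - s)"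
    "H 1 - H 0 \<le> 3 * \<tau>"
proof -
  have A: "A \<ge> 0" using lipschitz_on_nonneg[OF G] .
  \<comment> \<open>The discrete supremum of the increments. Both the mesh and the set of indices
    \<open>k\<close> are refined with \<open>m\<close>, and \<open>V m\<close> below sums
    \<open>D m\<close> over the intervals before \<open>s\<close>.\<close>
  define D where "D m i = Max ((\<lambda>k. \<bar>dyadic_increment (G k) m i\<bar>) ` {..m})" for m i
  define n where "n m s = nat \<lfloor>2 ^ m * s\<rfloor>" for m :: nat and s :: real
  define V where "V m s = (\<Sum>i<n m s. D m i)" for m s
  have D_ge: "\<bar>dyadic_increment (G k) m i\<bar> \<le> D m i" if "k \<le> m" for k m i
    using that by (auto simp: D_def intro!: Max_ge)
  have D_le: "D m i \<le> c" if "\<And>k. k \<le> m \<Longrightarrow> \<bar>dyadic_increment (G k) m i\<bar> \<le> c" for m i c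
    using that by (auto simp: D_def)
  have D_nonneg: "0 \<le> D m i" for m i using D_ge[of 0 m i] by simp
  have D_A: "D m i \<le> A / 2 ^ m" if "i < 2 ^ m" for m i
    using dyadic_increment_le[OF G that] by (intro D_le)
  have D_split: "D m i \<le> D (Suc m) (2 * i) + D (Suc m) (2 * i + 1)" for m i
  proof (rule D_le)
    fix k assume "k \<le> m"
    then show "\<bar>dyadic_increment (G k) m i\<bar> \<le> D (Suc m) (2 * i) + D (Suc m) (2 * i + 1)"
      using D_ge[of k "Suc m" "2 * i"] D_ge[of k "Suc m" "2 * i + 1"]
      unfolding dyadic_increment_split[of "G k" m] by linarith
  qed
  have n_bounds: "real (n m s) \<le> 2 ^ m * s" "2 ^ m * s \<le> real (n m s) + 1" if "0 \<le> s" for m s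
    using that by (auto simp: n_def)
  have n_le: "n m s \<le> 2 ^ m" if "0 \<le> s" "s \<le> 1" for m s
  proof -
    have "real (n m s) \<le> 2 ^ m * 1"
      using n_bounds(1)[OF that(1), of m] mult_left_mono[OF that(2), of "2 ^ m"]
      by (metis order_trans zero_le_numeral zero_le_power)
    then show ?thesis by (metis mult.right_neutral of_nat_le_iff of_nat_numeral of_nat_power)
  qed
  have n_mono: "n m s \<le> n m t" if "0 \<le> s" "s \<le> t" for m s t
    unfolding n_def using that by (intro nat_mono floor_mono mult_left_mono) auto
  have n_double: "2 * n m s \<le> n (Suc m) s" if "0 \<le> s" for m s
  proof -
    have "real (2 * n m s) \<le> 2 ^ Suc m * s" using n_bounds(1)[OF that, of m] by simp
    then show ?thesis unfolding n_def[of "Suc m"] by linarith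
  qed
  have V_Suc: "V m s \<le> V (Suc m) s" if "0 \<le> s" for m s
  proof -
    have "V m s \<le> (\<Sum>i<n m s. D (Suc m) (2 * i) + D (Suc m) (2 * i + 1))"
      unfolding V_def by (intro sum_mono D_split)
    also have "\<dots> = (\<Sum>i<2 * n m s. D (Suc m) i)" by (rule sum_lessThan_double[symmetric])
    also have "\<dots> \<le> V (Suc m) s"
      unfolding V_def using n_double[OF that, of m] D_nonneg by (intro sum_mono2) auto
    finally show ?thesis .
  qed
  have V_le: "V m s \<le> 3 * \<tau>" if s: "0 \<le> s" "s \<le> 1" for m s
  proof -
    \<comment> \<open>With this \<open>c\<close> the \<open>2 ^ m\<close> constant terms add up to
      \<open>\<tau>\<close>, and the quadratic terms to the sum of the energies over
      \<open>\<tau>\<close>, at most \<open>2 * \<tau>\<close>.\<close>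
    define c where "c = \<tau> / 2 ^ m"
    have c: "c > 0" using \<tau> by (simp add: c_def)
    have "V m s \<le> (\<Sum>i<2 ^ m. D m i)"
      unfolding V_def using n_le[OF s] D_nonneg by (intro sum_mono2) auto
    also have "\<dots> \<le> (\<Sum>i<2 ^ m. c + (\<Sum>k\<le>m. (dyadic_increment (G k) m i)\<^sup>2) / c)"
    proof (intro sum_mono D_le)
      fix i k assume k: "k \<le> m"
      define x where "x = dyadic_increment (G k) m i"
      have "0 \<le> \<bar>x\<bar> * c" using c by simp
      then have "\<bar>x\<bar> * c \<le> c\<^sup>2 + x\<^sup>2" using sum_squares_bound[of "\<bar>x\<bar>" c] unfolding power2_abs by linarith
      then have "\<bar>x\<bar> \<le> c + x\<^sup>2 / c" using c by (simp add: field_simps power2_eq_square)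
      also have "x\<^sup>2 / c \<le> (\<Sum>k\<le>m. (dyadic_increment (G k) m i)\<^sup>2) / c"
        using k c unfolding x_def by (intro divide_right_mono member_le_sum) auto
      finally show "\<bar>dyadic_increment (G k) m i\<bar> \<le> c + (\<Sum>k\<le>m. (dyadic_increment (G k) m i)\<^sup>2) / c"
        by (simp add: x_def)
    qed
    also have "\<dots> = 2 ^ m * c + (\<Sum>i<2 ^ m. \<Sum>k\<le>m. (dyadic_increment (G k) m i)\<^sup>2) / c"
      by (simp add: sum.distrib sum_divide_distrib)
    also have "(\<Sum>i<2 ^ m. \<Sum>k\<le>m. (dyadic_increment (G k) m i)\<^sup>2) =
        (\<Sum>k\<le>m. \<Sum>i<2 ^ m. (dyadic_increment (G k) m i)\<^sup>2)"
      by (rule sum.swap)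
    also have "2 ^ m * c + \<dots> / c = \<tau> + (\<Sum>k\<le>m. dyadic_energy (G k) m) / \<tau>"
      by (simp add: c_def dyadic_energy_def sum_distrib_left[symmetric])
    also have "\<dots> \<le> \<tau> + (\<tau>\<^sup>2 * 2) / \<tau>"
    proof (intro add_left_mono divide_right_mono)
      have "(\<Sum>k\<le>m. dyadic_energy (G k) m) \<le> (\<Sum>k\<le>m. \<tau>\<^sup>2 * (1 / 4) ^ k)"
        using E by (intro sum_mono) (simp add: power_one_over)
      also have "\<dots> = \<tau>\<^sup>2 * (\<Sum>k\<le>m. (1 / 4) ^ k)" by (rule sum_distrib_left[symmetric])
      also have "\<dots> \<le> \<tau>\<^sup>2 * 2"
      proof (rule mult_left_mono)
        have "(\<Sum>k\<le>m. (1 / 4 :: real) ^ k) = (1 - (1 / 4) ^ Suc m) / (1 - 1 / 4)"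
          by (simp add: sum_gp0)
        also have "\<dots> \<le> 1 / (1 - 1 / 4)" by (intro divide_right_mono) auto
        also have "\<dots> \<le> 2" by simp
        finally show "(\<Sum>k\<le>m. (1 / 4 :: real) ^ k) \<le> 2" .
      qed simp
      finally show "(\<Sum>k\<le>m. dyadic_energy (G k) m) \<le> \<tau>\<^sup>2 * 2" .
    qed (use \<tau> in simp)
    also have "\<dots> = 3 * \<tau>" using \<tau> by (simp add: power2_eq_square)
    finally show ?thesis .
  qed
  have "\<exists>L. (\<lambda>m. V m s) \<longlonglongrightarrow> L" if "0 \<le> s" "s \<le> 1" for s
  proof -
    have "incseq (\<lambda>m. V m s)" by (intro incseq_SucI V_Suc that)
    then show ?thesis using V_le[OF that] by (elim incseq_convergent) auto
  qed
  then obtain H where H: "\<And>s. 0 \<le> s \<Longrightarrow> s \<le> 1 \<Longrightarrow> (\<lambda>m. V m s) \<longlonglongrightarrow> H s" by metis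
  have diff: "V m t - V m s = (\<Sum>i\<in>{n m s..<n m t}. D m i)" if "0 \<le> s" "s \<le> t" for m s t
    unfolding V_def using n_mono[OF that, of m]
    by (simp add: lessThan_atLeast0 sum_diff_nat_ivl[of 0])
  have null: "(\<lambda>m. c / 2 ^ m) \<longlonglongrightarrow> 0" for c :: real
    by (rule LIMSEQ_divide_realpow_zero) simp
  show ?thesis
  proof
    fix k s t assume st: "0 \<le> s" "s \<le> t" "t \<le> (1::real)"
    have lim: "(\<lambda>m. V m t - V m s) \<longlonglongrightarrow> H t - H s"
      using H st by (intro tendsto_diff) auto
    \<comment> \<open>The cost of rounding \<open>r\<close> down to the dyadic grid of level
      \<open>m\<close>.\<close>
    have approx: "\<bar>G k (real (n m r) / 2 ^ m) - G k r\<bar> \<le> A / 2 ^ m" if "0 \<le> r" "r \<le> 1" for m r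
    proof -
      have "real (n m r) / 2 ^ m \<le> r" "r \<le> (real (n m r) + 1) / 2 ^ m"
        using n_bounds[OF that(1), of m] by (auto simp: field_simps)
      then have "dist (real (n m r) / 2 ^ m) r \<le> 1 / 2 ^ m"
        by (simp add: dist_real_def add_divide_distrib)
      then have "A * dist (real (n m r) / 2 ^ m) r \<le> A * (1 / 2 ^ m)" using A by (rule mult_left_mono)
      moreover have "dist (G k (real (n m r) / 2 ^ m)) (G k r) \<le> A * dist (real (n m r) / 2 ^ m) r"
        using that \<open>real (n m r) / 2 ^ m \<le> r\<close>
        by (intro lipschitz_onD[OF G]) (auto simp: n_le)
      ultimately show ?thesis by (simp add: dist_real_def)
    qed
    \<comment> \<open>Only from level \<open>k\<close> on does \<open>D m\<close> take
      \<open>G k\<close> into account.\<close>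
    have low: "\<bar>G k t - G k s\<bar> - 2 * A / 2 ^ m \<le> V m t - V m s" if "k \<le> m" for m
    proof -
      have "G k (real (n m t) / 2 ^ m) - G k (real (n m s) / 2 ^ m) =
          (\<Sum>i\<in>{n m s..<n m t}. dyadic_increment (G k) m i)"
        using sum_Suc_diff'[OF n_mono[OF st(1,2), of m], of "\<lambda>i. G k (real i / 2 ^ m)"]
        by (simp add: dyadic_increment_def add.commute)
      also have "\<bar>\<dots>\<bar> \<le> (\<Sum>i\<in>{n m s..<n m t}. D m i)"
        using D_ge[OF that] by (intro order_trans[OF sum_abs] sum_mono)
      finally have "\<bar>G k (real (n m t) / 2 ^ m) - G k (real (n m s) / 2 ^ m)\<bar> \<le> V m t - V m s"
        by (simp add: diff[OF st(1,2)])
      then show ?thesis using approx[of s m] approx[of t m] st by (simp add: abs_le_iff) linarith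
    qed
    show "\<bar>G k t - G k s\<bar> \<le> H t - H s"
    proof (rule LIMSEQ_le[OF _ lim])
      show "(\<lambda>m. \<bar>G k t - G k s\<bar> - 2 * A / 2 ^ m) \<longlonglongrightarrow> \<bar>G k t - G k s\<bar>"
        using tendsto_diff[OF tendsto_const null[of "2 * A"]] by simp
    qed (use low in blast)
  next
    fix s t assume st: "0 \<le> s" "s \<le> t" "t \<le> (1::real)"
    have lim: "(\<lambda>m. V m t - V m s) \<longlonglongrightarrow> H t - H s"
      using H st by (intro tendsto_diff) auto
    have "V m t - V m s \<le> A * (t - s) + A / 2 ^ m" for m
    proof -
      have "V m t - V m s \<le> (\<Sum>i\<in>{n m s..<n m t}. A / 2 ^ m)"
        unfolding diff[OF st(1,2)] using n_le[of t m] st by (intro sum_mono D_A) auto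
      also have "\<dots> = (real (n m t) - real (n m s)) * (A / 2 ^ m)"
        using n_mono[OF st(1,2), of m] by (simp add: of_nat_diff)
      also have "\<dots> \<le> (2 ^ m * t - (2 ^ m * s - 1)) * (A / 2 ^ m)"
        using n_bounds[of s m] n_bounds[of t m] st A by (intro mult_right_mono) auto
      also have "\<dots> = A * (t - s) + A / 2 ^ m" by (simp add: field_simps)
      finally show ?thesis .
    qed
    moreover have "(\<lambda>m. A * (t - s) + A / 2 ^ m) \<longlonglongrightarrow> A * (t - s)"
      using tendsto_add[OF tendsto_const null[of A]] by simp
    ultimately show "H t - H s \<le> A * (t - s)" using LIMSEQ_le[OF lim] by blast
  next
    have "H 1 \<le> 3 * \<tau>" using H[of 1] V_le[of 1] by (intro LIMSEQ_le_const2[of "\<lambda>m. V m 1"]) auto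
    moreover have "H 0 = 0" using H[of 0] by (intro LIMSEQ_unique[of "\<lambda>m. V m 0"]) (auto simp: V_def n_def)
    ultimately show "H 1 - H 0 \<le> 3 * \<tau>" by simp
  qed
qed

section \<open>Subsets of a line\<close>

lemma lipschitz_along_segment:
  fixes a b :: "'a::real_normed_vector"
  assumes "convex M" "a \<in> M" "b \<in> M" "f \<in> Lip0 M p" "lip_norm M f \<le> C"
  shows "(C * dist a b)-lipschitz_on {0..1} (\<lambda>s. f (a + s *\<^sub>R (b - a)))"
proof (rule lipschitz_onI)
  have C: "0 \<le> C" using lip_norm_nonneg[OF assms(4)] assms(5) by simp
  then show "0 \<le> C * dist a b" by simp
  fix s t :: real assume st: "s \<in> {0..1}" "t \<in> {0..1}"
  have in_M: "a + r *\<^sub>R (b - a) \<in> M" if "r \<in> {0..1}" for r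
    using convexD_alt[OF assms(1-3), of r] that by (simp add: algebra_simps)
  have "dist (f (a + s *\<^sub>R (b - a))) (f (a + t *\<^sub>R (b - a))) \<le>
      C * dist (a + s *\<^sub>R (b - a)) (a + t *\<^sub>R (b - a))"
    using lip_norm_abs_bound[OF assms(4) in_M[OF st(1)] in_M[OF st(2)]]
      mult_right_mono[OF assms(5) zero_le_dist[of "a + s *\<^sub>R (b - a)" "a + t *\<^sub>R (b - a)"]]
    unfolding dist_real_def by linarith
  also have "dist (a + s *\<^sub>R (b - a)) (a + t *\<^sub>R (b - a)) = dist a b * dist s t"
    by (simp add: dist_norm scaleR_diff_left[symmetric] norm_minus_commute mult.commute)
  finally show "dist (f (a + s *\<^sub>R (b - a))) (f (a + t *\<^sub>R (b - a))) \<le> C * dist a b * dist s t"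
    by (simp add: mult.assoc)
qed

context lip_predual
begin

definition along :: "'a \<Rightarrow> 'a \<Rightarrow> ('a \<Rightarrow> real) \<Rightarrow> real \<Rightarrow> real"
  where "along a b f s = f (a + s *\<^sub>R (b - a))"

definition supported_in_segment :: "'a \<Rightarrow> 'a \<Rightarrow> ('a \<Rightarrow> real) \<Rightarrow> bool"
  where "supported_in_segment a b f \<longleftrightarrow> (\<forall>x\<in>M - open_segment a b. f x = 0)"

text \<open>Each summand is chosen after the previous ones and uniformly so small that it is almost
  orthogonal to their sum. Hence the energy bound grows linearly in \<open>n\<close>, not
  quadratically.\<close>

lemma low_energy_sum:
  assumes M: "convex M" "a \<in> M" "b \<in> M" and \<psi>: "\<psi> \<in> Y"
    and src: "\<And>\<delta>. \<delta> > 0 \<Longrightarrow> \<exists>h\<in>Lip0 M p. lip_norm M h \<le> 2 \<and> \<epsilon> \<le> \<psi> h \<and>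
      supported_in_segment a b h \<and> (\<forall>x\<in>M. \<bar>h x\<bar> \<le> \<delta>)"
  shows "\<exists>S\<in>Lip0 M p. lip_norm M S \<le> 2 * real n \<and> real n * \<epsilon> \<le> \<psi> S \<and> supported_in_segment a b S \<and>
    (\<forall>m. dyadic_energy (along a b S) m \<le> real n * ((2 * dist a b)\<^sup>2 + 1))"
proof (induction n)
  case 0
  have "dyadic_energy (along a b 0) m = 0" for m
    by (simp add: dyadic_energy_def dyadic_increment_def along_def)
  moreover have "\<psi> 0 = 0" using dual_spaceD(4)[OF predual_dual[OF \<psi>]] .
  moreover have "supported_in_segment a b 0" by (simp add: supported_in_segment_def)
  ultimately show ?case
    by (intro bexI[of _ 0] conjI allI carrier_closed(1))
      (simp_all only: norm_zero of_nat_0 mult_zero_left mult_zero_right order_refl)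
next
  case (Suc n)
  then obtain S where S: "S \<in> Lip0 M p" "lip_norm M S \<le> 2 * real n" "real n * \<epsilon> \<le> \<psi> S"
    "supported_in_segment a b S"
    "\<And>m. dyadic_energy (along a b S) m \<le> real n * ((2 * dist a b)\<^sup>2 + 1)" by blast
  have lip: "(C * dist a b)-lipschitz_on {0..1} (along a b f)"
    if "f \<in> Lip0 M p" "lip_norm M f \<le> C" for f C
    using lipschitz_along_segment[OF M that] by (simp add: along_def[abs_def])
  obtain \<delta> where \<delta>: "\<delta> > 0" "\<And>K m. (2 * dist a b)-lipschitz_on {0..1} K \<Longrightarrow>
      (\<And>s. s \<in> {0..1} \<Longrightarrow> \<bar>K s\<bar> \<le> \<delta>) \<Longrightarrow>
      dyadic_energy (\<lambda>s. along a b S s + K s) m \<le> real n * ((2 * dist a b)\<^sup>2 + 1) + (2 * dist a b)\<^sup>2 + 1"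
    using dyadic_energy_add_small[OF lip[OF S(1,2)] S(5), where A = "2 * dist a b"] by blast
  obtain h where h: "h \<in> Lip0 M p" "lip_norm M h \<le> 2" "\<epsilon> \<le> \<psi> h" "supported_in_segment a b h"
    "\<And>x. x \<in> M \<Longrightarrow> \<bar>h x\<bar> \<le> \<delta>"
    using src[OF \<delta>(1)] by blast
  have "\<bar>along a b h s\<bar> \<le> \<delta>" if "s \<in> {0..1}" for s
    using convexD_alt[OF M, of s] that h(5) by (simp add: along_def algebra_simps)
  from \<delta>(2)[OF lip[OF h(1,2)] this]
  have "dyadic_energy (along a b (S + h)) m \<le> real (Suc n) * ((2 * dist a b)\<^sup>2 + 1)" for m
    by (simp add: along_def[abs_def] algebra_simps)
  moreover have "lip_norm M (S + h) \<le> 2 * real (Suc n)"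
    using norm_triangle[OF S(1) h(1)] S(2) h(2) by simp
  moreover have "real (Suc n) * \<epsilon> \<le> \<psi> (S + h)"
    using S(1,3) h(1,3) by (simp add: dual_spaceD predual_dual \<psi> algebra_simps)
  moreover have "supported_in_segment a b (S + h)"
    using S(4) h(4) by (simp add: supported_in_segment_def)
  ultimately show ?case using carrier_closed(2)[OF S(1) h(1)] by blast
qed

text \<open>An averaging of Banach-Saks type: dividing the sum by \<open>n\<close> divides its
  energy by the square of \<open>n\<close>, while the lower bound \<open>\<epsilon>\<close> under
  \<open>\<psi>\<close> survives.\<close>

lemma low_energy_average:
  assumes M: "convex M" "a \<in> M" "b \<in> M" and \<psi>: "\<psi> \<in> Y"
    and src: "\<And>\<delta>. \<delta> > 0 \<Longrightarrow> \<exists>h\<in>Lip0 M p. lip_norm M h \<le> 2 \<and> \<epsilon> \<le> \<psi> h \<and>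
      supported_in_segment a b h \<and> (\<forall>x\<in>M. \<bar>h x\<bar> \<le> \<delta>)"
    and e: "e > 0"
  shows "\<exists>g\<in>Lip0 M p. lip_norm M g \<le> 2 \<and> \<epsilon> \<le> \<psi> g \<and> supported_in_segment a b g \<and>
    (\<forall>m. dyadic_energy (along a b g) m \<le> e)"
proof -
  define c where "c = (2 * dist a b)\<^sup>2 + 1"
  have c: "c > 0" by (simp add: c_def add_nonneg_pos)
  obtain n :: nat where n: "c / e < real n" using reals_Archimedean2 by blast
  have "0 < c / e" using c e by simp
  then have n0: "real n > 0" using n by linarith
  obtain S where S: "S \<in> Lip0 M p" "lip_norm M S \<le> 2 * real n" "real n * \<epsilon> \<le> \<psi> S"
    "supported_in_segment a b S" "\<And>m. dyadic_energy (along a b S) m \<le> real n * c"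
    using low_energy_sum[OF M \<psi> src, of n] unfolding c_def by blast
  have "dyadic_energy (along a b ((1 / real n) *\<^sub>R S)) m \<le> e" for m
  proof -
    have "dyadic_energy (along a b ((1 / real n) *\<^sub>R S)) m = (1 / real n)\<^sup>2 * dyadic_energy (along a b S) m"
      using dyadic_energy_scale[of "1 / real n" "along a b S" m] by (simp add: along_def[abs_def])
    also have "\<dots> \<le> (1 / real n)\<^sup>2 * (real n * c)" using S(5) by (intro mult_left_mono) auto
    also have "\<dots> = c / real n" using n0 by (simp add: power2_eq_square)
    also have "\<dots> \<le> e" using n n0 e by (simp add: field_simps)
    finally show ?thesis .
  qed
  moreover have "lip_norm M ((1 / real n) *\<^sub>R S) \<le> 2"
    using S(2) n0 by (simp add: norm_scale[OF S(1)] divide_le_eq)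
  moreover have "\<epsilon> \<le> \<psi> ((1 / real n) *\<^sub>R S)"
    using S(3) n0 by (simp add: dual_spaceD(2)[OF predual_dual[OF \<psi>] S(1)] le_divide_eq mult.commute)
  moreover have "supported_in_segment a b ((1 / real n) *\<^sub>R S)"
    using S(4) by (simp add: supported_in_segment_def)
  ultimately show ?thesis using S(1) by (intro bexI[of _ "(1 / real n) *\<^sub>R S"]) auto
qed

text \<open>Averages with energies at most \<open>1 / 4 ^ k\<close> are dominated from index
  \<open>n\<close> on by an increasing function of slope at most 2 and total increment at most
  \<open>3 / 2 ^ n\<close>. Domination passes to a cluster point, which must be 0 although
  \<open>\<psi>\<close> is at least \<open>\<epsilon>\<close> on it.\<close>

lemma no_weakly_large_small_functions:
  assumes M: "convex M" "a \<in> M" "b \<in> M" "a \<noteq> b" and line: "\<And>x. x \<in> M \<Longrightarrow> \<exists>s. x = a + s *\<^sub>R (b - a)"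
    and \<psi>: "\<psi> \<in> Y" and \<epsilon>: "\<epsilon> > 0"
    and src: "\<And>\<delta>. \<delta> > 0 \<Longrightarrow> \<exists>h\<in>Lip0 M p. lip_norm M h \<le> 2 \<and> \<epsilon> \<le> \<psi> h \<and>
      supported_in_segment a b h \<and> (\<forall>x\<in>M. \<bar>h x\<bar> \<le> \<delta>)"
  shows False
proof -
  define D where "D = dist a b"
  have D: "D > 0" using M(4) by (simp add: D_def)
  \<comment> \<open>The coordinate along the line, with \<open>a\<close> at 0 and \<open>b\<close>
    at 1.\<close>
  obtain u where u: "\<And>x. x \<in> M \<Longrightarrow> x = a + u x *\<^sub>R (b - a)" using line by metis
  have dist_u: "dist x y = \<bar>u x - u y\<bar> * D" if "x \<in> M" "y \<in> M" for x y
  proof -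
    have "x - y = (u x - u y) *\<^sub>R (b - a)"
      using u[OF that(1)] u[OF that(2)] by (metis add_diff_cancel_left scaleR_diff_left)
    then show ?thesis by (simp add: dist_norm D_def norm_minus_commute)
  qed
  have "\<exists>g\<in>Lip0 M p. lip_norm M g \<le> 2 \<and> \<epsilon> \<le> \<psi> g \<and> supported_in_segment a b g \<and>
      (\<forall>m. dyadic_energy (along a b g) m \<le> 1 / 4 ^ k)" for k :: nat
    by (rule low_energy_average[OF M(1-3) \<psi> src]) auto
  then obtain g where g: "\<And>k. g k \<in> Lip0 M p" "\<And>k. lip_norm M (g k) \<le> 2" "\<And>k. \<epsilon> \<le> \<psi> (g k)"
    "\<And>k. supported_in_segment a b (g k)" "\<And>k m. dyadic_energy (along a b (g k)) m \<le> 1 / 4 ^ k"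
    by metis
  obtain G f where G: "G \<le> sequentially" "G \<noteq> bot" and lim: "weak_tendsto g f G"
    by (rule bounded_weak_cluster[OF sequentially_bot g(1,2)])
  have f: "f \<in> Lip0 M p" using lim by (simp add: weak_tendsto_def)
  \<comment> \<open>Clamping the coordinate to the unit interval loses nothing, as every
    \<open>g k\<close> vanishes outside the open segment and at its ends.\<close>
  define cl where "cl x = min 1 (max 0 (u x))" for x
  have cl01: "0 \<le> cl x" "cl x \<le> 1" for x by (auto simp: cl_def)
  have g_cl: "g k x = along a b (g k) (cl x)" if x: "x \<in> M" for k x
  proof (cases "0 < u x \<and> u x < 1")
    case True
    then show ?thesis using u[OF x] by (simp add: along_def cl_def)
  next
    case False
    have notin: "a + s *\<^sub>R (b - a) \<notin> open_segment a b" if "\<not> (0 < s \<and> s < 1)" for s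
    proof
      assume "a + s *\<^sub>R (b - a) \<in> open_segment a b"
      then obtain t where t: "0 < t" "t < 1" "a + s *\<^sub>R (b - a) = (1 - t) *\<^sub>R a + t *\<^sub>R b"
        by (auto simp: in_segment)
      then have "(s - t) *\<^sub>R (b - a) = 0" by (simp add: algebra_simps)
      then show False using M(4) t that by auto
    qed
    have "g k x = 0"
      using notin[OF False] u[OF x] x g(4)[of k] unfolding supported_in_segment_def by (metis DiffI)
    moreover have "cl x = 0 \<or> cl x = 1" using False by (auto simp: cl_def)
    then have "along a b (g k) (cl x) = 0"
      using g(4)[of k] M(2,3) by (auto simp: along_def supported_in_segment_def open_segment_def)
    ultimately show ?thesis by simp
  qed
  have osc: "f y - f x \<le> 3 / 2 ^ n" if xy: "x \<in> M" "y \<in> M" for x y n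
  proof -
    have lip: "(2 * D)-lipschitz_on {0..1} (along a b (g k))" for k
      using lipschitz_along_segment[OF M(1-3) g(1,2), of k] by (simp add: along_def[abs_def] D_def)
    obtain H where H1: "\<And>k s t. 0 \<le> s \<Longrightarrow> s \<le> t \<Longrightarrow> t \<le> 1 \<Longrightarrow>
        \<bar>along a b (g (n + k)) t - along a b (g (n + k)) s\<bar> \<le> H t - H s"
      and H2: "\<And>s t. 0 \<le> s \<Longrightarrow> s \<le> t \<Longrightarrow> t \<le> 1 \<Longrightarrow> H t - H s \<le> 2 * D * (t - s)"
      and H3: "H 1 - H 0 \<le> 3 * (1 / 2 ^ n)"
    \<comment> \<open>For the tail starting at \<open>n\<close> the scale is
      \<open>1 / 2 ^ n\<close>, because \<open>1 / 4 ^ (n + k)\<close> is its square divided by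
      \<open>4 ^ k\<close>.\<close>
    proof (rule dominating_function[of "2 * D" "\<lambda>k. along a b (g (n + k))" "1 / 2 ^ n"])
      fix k m
      have "(1 / 2 ^ n :: real)\<^sup>2 / 4 ^ k = 1 / 4 ^ (n + k)"
        by (simp add: power2_eq_square power_add power_mult_distrib[symmetric])
      then show "dyadic_energy (along a b (g (n + k))) m \<le> (1 / 2 ^ n)\<^sup>2 / 4 ^ k" using g(5)[of "n + k" m] by simp
    qed (use lip in auto)
    \<comment> \<open>\<open>h\<close> is the dominating function on \<open>M\<close>, and
      \<open>v\<close> has the constant slope 2. The functions whose increments are dominated by
      those of \<open>h\<close> form the intersection of the balls of radius 2 around
      \<open>w = h - v\<close> and \<open>- w\<close>.\<close>
    define h where "h x = (if x \<in> M then H (cl x) - H (cl p) else 0)" for x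
    define v where "v x = (if x \<in> M then 2 * D * (u x - u p) else 0)" for x
    define w where "w = h - v"
    have cl_mono: "cl x \<le> cl y" "cl y - cl x \<le> u y - u x" if "u x \<le> u y" for x y
      using that by (auto simp: cl_def)
    have h_le: "\<bar>g k y - g k x\<bar> \<le> h y - h x" "h y - h x \<le> 2 * dist x y"
      if "x \<in> M" "y \<in> M" "u x \<le> u y" "n \<le> k" for x y k
    proof -
      obtain j where j: "k = n + j" using \<open>n \<le> k\<close> le_Suc_ex by blast
      show "\<bar>g k y - g k x\<bar> \<le> h y - h x"
        using H1[OF cl01(1) cl_mono(1)[OF that(3)] cl01(2), of j] that by (simp add: g_cl h_def j)
      have "H (cl y) - H (cl x) \<le> 2 * D * (cl y - cl x)"
        by (rule H2[OF cl01(1) cl_mono(1)[OF that(3)] cl01(2)])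
      also have "\<dots> \<le> 2 * D * (u y - u x)" using cl_mono(2)[OF that(3)] D by (intro mult_left_mono) auto
      finally show "h y - h x \<le> 2 * dist x y"
        using that dist_u[OF that(1,2)] by (simp add: h_def algebra_simps)
    qed
    have v_diff: "v y - v x = 2 * dist x y" if "x \<in> M" "y \<in> M" "u x \<le> u y" for x y
      using that dist_u[OF that(1,2)] by (simp add: v_def algebra_simps)
    have slope: "\<bar>(g k x - w x) - (g k y - w y)\<bar> \<le> 2 * dist x y \<and>
        \<bar>(g k x + w x) - (g k y + w y)\<bar> \<le> 2 * dist x y" if "x \<in> M" "y \<in> M" "n \<le> k" for x y k
    proof -
      have "\<bar>(g k x - w x) - (g k y - w y)\<bar> \<le> 2 * dist x y \<and>
        \<bar>(g k x + w x) - (g k y + w y)\<bar> \<le> 2 * dist x y" if "x \<in> M" "y \<in> M" "u x \<le> u y" for x y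
        using h_le[OF that \<open>n \<le> k\<close>] v_diff[OF that] by (simp add: w_def abs_le_iff)
      from this[of x y] this[of y x] show ?thesis
        using that by (cases "u x \<le> u y") (auto simp: dist_commute abs_minus_commute)
    qed
    have w: "w \<in> Lip0 M p"
    proof (rule Lip0I[where C = 4])
      fix x y assume xy: "x \<in> M" "y \<in> M"
      show "w x - w y \<le> 4 * dist x y"
        using slope[OF xy order_refl] lip_norm_abs_bound[OF g(1) xy, of n]
          mult_right_mono[OF g(2)[of n] zero_le_dist[of x y]] by (simp add: abs_le_iff)
    qed (use base_in in \<open>auto simp: w_def h_def v_def\<close>)
    have late: "\<forall>\<^sub>F k in G. n \<le> k" using G(1) eventually_ge_at_top[of n] by (auto simp: le_filter_def)
    have le1: "lip_norm M (f - w) \<le> 2"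
    proof (rule weak_tendsto_norm_le[OF lim G(2) g(1) w])
      show "\<forall>\<^sub>F k in G. lip_norm M (g k - w) \<le> 2"
        using late by eventually_elim (use slope in \<open>auto intro!: lip_norm_le simp: abs_le_iff\<close>)
    qed
    have le2: "lip_norm M (f - - w) \<le> 2"
    proof (rule weak_tendsto_norm_le[OF lim G(2) g(1)])
      show "\<forall>\<^sub>F k in G. lip_norm M (g k - - w) \<le> 2"
        using late by eventually_elim (use slope in \<open>auto intro!: lip_norm_le simp: abs_le_iff\<close>)
    qed (use w in auto)
    \<comment> \<open>Since \<open>v\<close> has slope exactly 2, its increments cancel the radius,
      leaving the increments of \<open>h\<close> as bounds.\<close>
    have f_le: "\<bar>f y - f x\<bar> \<le> h y - h x" if "x \<in> M" "y \<in> M" "u x \<le> u y" for x y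
    proof -
      have "(f - w) y - (f - w) x \<le> 2 * dist x y"
        using lip_norm_bound[of "f - w" M p y x] mult_right_mono[OF le1 zero_le_dist[of x y]] f w that
        by (simp add: dist_commute)
      moreover have "(f - - w) x - (f - - w) y \<le> 2 * dist x y"
        using lip_norm_bound[of "f - - w" M p x y] mult_right_mono[OF le2 zero_le_dist[of x y]] f w that
        by simp
      ultimately show ?thesis using v_diff[OF that] by (simp add: w_def)
    qed
    have h_total: "h y - h x \<le> 3 / 2 ^ n" if "x \<in> M" "y \<in> M" "u x \<le> u y" for x y
    proof -
      have "H (cl y) \<le> H 1" "H 0 \<le> H (cl x)"
        using H1[of "cl y" 1 0] H1[of 0 "cl x" 0] cl01[of x] cl01[of y] by auto
      then show ?thesis using H3 that by (simp add: h_def)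
    qed
    show ?thesis
      using f_le[of x y] h_total[of x y] f_le[of y x] h_total[of y x] xy
      by (cases "u x \<le> u y") (auto simp: abs_le_iff)
  qed
  have "f y - f x \<le> 0" if xy: "x \<in> M" "y \<in> M" for x y
  proof (rule LIMSEQ_le_const[OF LIMSEQ_divide_realpow_zero[of 2 3]])
    show "\<exists>N. \<forall>n\<ge>N. f y - f x \<le> 3 / 2 ^ n" using osc[OF xy] by blast
  qed simp
  from this[OF base_in] this[OF _ base_in] have "f x = 0" if "x \<in> M" for x
    using that Lip0D(1)[OF f] by (simp add: antisym)
  then have "f = 0" using Lip0D(2)[OF f] by (intro ext) (metis zero_fun_apply)
  then have "\<psi> f = 0" using dual_spaceD(4)[OF predual_dual[OF \<psi>]] by simp
  moreover have "((\<lambda>k. \<psi> (g k)) \<longlongrightarrow> \<psi> f) G" using lim \<psi> by (simp add: weak_tendsto_def)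
  then have "\<epsilon> \<le> \<psi> f" using g(3) G(2) by (intro tendsto_lowerbound[of _ _ G]) auto
  ultimately show False using \<epsilon> by simp
qed

text \<open>Cutting off to a slightly shorter segment gives uniformly small functions supported
  between \<open>a\<close> and \<open>b\<close>; their weak* limit \<open>g\<close> vanishes by the
  previous lemma. So \<open>F\<close> takes equal values at the ends of the shorter segment, which
  is then extended to the whole one.\<close>

lemma small_sequence_limit_on_line:
  assumes f: "small_sequence f" and lim: "weak_tendsto f F G" "G \<noteq> bot" "G \<le> sequentially"
    and M: "convex M" "a \<in> M" "b \<in> M" "a \<noteq> b" and line: "\<And>x. x \<in> M \<Longrightarrow> \<exists>s. x = a + s *\<^sub>R (b - a)"
  shows "F a = F b"
proof -
  define D where "D = dist a b"
  have D: "D > 0" using M(4) by (simp add: D_def)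
  have F: "F \<in> Lip0 M p" using lim(1) by (simp add: weak_tendsto_def)
  have inner: "F (a + t *\<^sub>R (b - a)) = F (b - t *\<^sub>R (b - a))" if t: "0 < t" "t < 1 / 2" for t
  proof -
    define a' where "a' = a + t *\<^sub>R (b - a)"
    define b' where "b' = b - t *\<^sub>R (b - a)"
    \<comment> \<open>Points of \<open>M\<close> outside the open segment from \<open>a\<close> to
      \<open>b\<close> have distance at least \<open>t * D = 2 * \<eta>\<close> from the inner
      segment, where the cutoff vanishes.\<close>
    define \<eta> where "\<eta> = t * D / 2"
    have \<eta>: "\<eta> > 0" using t D by (simp add: \<eta>_def)
    have "a' \<in> M" "b' \<in> M"
      using convexD_alt[OF M(1-3), of t] convexD_alt[OF M(1-3), of "1 - t"] t
      by (auto simp: a'_def b'_def algebra_simps)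
    then have seg: "closed_segment a' b' \<subseteq> M" using M(1) by (simp add: closed_segment_subset)
    let ?\<theta> = "segment_cutoff a' b' \<eta>"
    have nonneg: "0 \<le> 1 / \<eta>" "0 \<le> dist a' p + dist a' b' + 2 * \<eta>" using \<eta> by auto
    obtain G' g where G': "G' \<le> G" "G' \<noteq> bot" and g: "weak_tendsto (\<lambda>n. ?\<theta> * f n) g G'"
      and gX: "g \<in> Lip0 M p" and "lip_norm M g \<le> 2"
      and cutX: "\<forall>n. ?\<theta> * f n \<in> Lip0 M p"
      and cut2: "\<forall>\<^sub>F n in sequentially. lip_norm M (?\<theta> * f n) \<le> 2"
      and "flat_on g {x. ?\<theta> x = 0}" and flat: "flat_on (F - g) {x. ?\<theta> x = 1}"
      by (rule cutoff_limit[OF f lim segment_cutoff_ge[OF \<eta>] segment_cutoff_le[OF \<eta>] nonneg(1)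
            segment_cutoff_lipschitz[OF \<eta>] segment_cutoff_support[OF \<eta>] nonneg(2)])
    have supp: "supported_in_segment a b (?\<theta> * f n)" for n
      unfolding supported_in_segment_def
    proof
      fix x assume x: "x \<in> M - open_segment a b"
      then obtain s where s: "x = a + s *\<^sub>R (b - a)" using line by blast
      have s01: "s \<le> 0 \<or> 1 \<le> s"
      proof (rule ccontr)
        assume "\<not> ?thesis"
        then have "x \<in> open_segment a b"
          using s M(4) by (auto simp: in_segment algebra_simps intro!: exI[of _ s])
        then show False using x by simp
      qed
      have "?\<theta> x = 0"
      proof (rule segment_cutoff_eq_0[OF \<eta>])
        fix y assume "y \<in> closed_segment a' b'"
        then obtain r where r: "0 \<le> r" "r \<le> 1" "y = (1 - r) *\<^sub>R a' + r *\<^sub>R b'"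
          by (auto simp: in_segment)
        define q where "q = (1 - r) * t + r * (1 - t)"
        have "0 \<le> r * (1 - 2 * t)" "r * (1 - 2 * t) \<le> 1 * (1 - 2 * t)"
          using r t by (auto intro!: mult_right_mono)
        then have q: "t \<le> q" "q \<le> 1 - t" by (auto simp: q_def algebra_simps)
        have "y = a + q *\<^sub>R (b - a)"
          unfolding r(3) a'_def b'_def q_def by (simp add: algebra_simps scaleR_2[symmetric])
        then have "dist y x = \<bar>q - s\<bar> * D"
          by (simp add: s dist_norm D_def scaleR_diff_left[symmetric] norm_minus_commute)
        moreover have "t \<le> \<bar>q - s\<bar>" using q s01 by linarith
        ultimately show "2 * \<eta> \<le> dist y x" using D by (simp add: \<eta>_def)
      qed
      then show "(?\<theta> * f n) x = 0" by simp
    qed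
    have "g = 0"
    proof (rule ccontr)
      assume "g \<noteq> 0"
      then obtain \<psi>0 where \<psi>0: "\<psi>0 \<in> Y" "\<psi>0 g \<noteq> 0" using predual_separates[OF gX] by blast
      \<comment> \<open>Normalised to value 1 at \<open>g\<close>, so that the values along
        \<open>G'\<close> eventually exceed 1/2.\<close>
      define \<psi> where "\<psi> = (1 / \<psi>0 g) *\<^sub>R \<psi>0"
      have \<psi>: "\<psi> \<in> Y" "\<psi> g = 1" using \<psi>0 by (auto simp: \<psi>_def)
      have "((\<lambda>n. \<psi> (?\<theta> * f n)) \<longlongrightarrow> 1) G'" using g \<psi> by (auto simp: weak_tendsto_def)
      then have large: "\<forall>\<^sub>F n in G'. 1 / 2 < \<psi> (?\<theta> * f n)" by (rule order_tendstoD) simp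
      show False
      proof (rule no_weakly_large_small_functions[OF M line \<psi>(1), of "1 / 2"])
        fix \<delta> :: real assume \<delta>: "\<delta> > 0"
        \<comment> \<open>\<open>R\<close> bounds the support of the cutoff; for \<open>n\<close>
          beyond \<open>R\<close> and \<open>1 / \<delta>\<close> the function \<open>f n\<close> is
          at most \<open>\<delta>\<close> there.\<close>
        define R where "R = dist a' p + dist a' b' + 2 * \<eta>"
        have "\<forall>\<^sub>F n in sequentially. real n \<ge> max R (1 / \<delta>)"
          using filterlim_real_sequentially unfolding filterlim_at_top by blast
        then have "\<forall>\<^sub>F n in G'. max R (1 / \<delta>) \<le> real n \<and> lip_norm M (?\<theta> * f n) \<le> 2 \<and> 1 / 2 < \<psi> (?\<theta> * f n)"
          using cut2 large order_trans[OF G'(1) lim(3)] by (intro eventually_conj) (auto dest: filter_leD)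
        then obtain n where n: "max R (1 / \<delta>) \<le> real n" "lip_norm M (?\<theta> * f n) \<le> 2" "1 / 2 < \<psi> (?\<theta> * f n)"
          using G'(2) eventually_happens by blast
        have "\<bar>(?\<theta> * f n) x\<bar> \<le> \<delta>" if x: "x \<in> M" for x
        proof (cases "?\<theta> x = 0")
          case False
          have "dist x p \<le> real n" using segment_cutoff_support[OF \<eta> False] n(1) by (simp add: R_def)
          then have "\<bar>f n x\<bar> \<le> 1 / (real n + 1)" using f x by (simp add: small_sequence_def)
          also have "\<dots> \<le> \<delta>"
          proof -
            have "1 \<le> real n * \<delta>" using n(1) \<delta> by (simp add: divide_le_eq)
            then show ?thesis using \<delta> by (simp add: divide_le_eq distrib_left mult.commute)
          qed
          finally have "\<bar>?\<theta> x\<bar> * \<bar>f n x\<bar> \<le> 1 * \<delta>"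
            using segment_cutoff_ge[OF \<eta>, of a' b' x] segment_cutoff_le[OF \<eta>, of a' b' x]
            by (intro mult_mono) auto
          then show ?thesis by (simp add: abs_mult)
        qed (use \<delta> in simp)
        then show "\<exists>h\<in>Lip0 M p. lip_norm M h \<le> 2 \<and> 1 / 2 \<le> \<psi> h \<and>
            supported_in_segment a b h \<and> (\<forall>x\<in>M. \<bar>h x\<bar> \<le> \<delta>)"
          using cutX supp n by (intro bexI[of _ "?\<theta> * f n"]) auto
      qed simp_all
    qed
    have "(F - g) a' = (F - g) b'"
    proof (rule flat_onD[OF flat _ seg])
      show "y \<in> {x. ?\<theta> x = 1}" if "x \<in> closed_segment a' b'" "dist x y < \<eta>" for x y
        using segment_cutoff_eq_1[OF \<eta> that] by simp
    qed (use \<eta> in auto)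
    then show ?thesis using \<open>g = 0\<close> by (simp add: a'_def b'_def)
  qed
  define c where "c = 2 * lip_norm M F * D"
  have c: "c \<ge> 0" using lip_norm_nonneg[OF F] D by (simp add: c_def)
  have est: "\<bar>F a - F b\<bar> \<le> t * c" if t: "0 < t" "t < 1 / 2" for t
  proof -
    have in_M: "a + t *\<^sub>R (b - a) \<in> M" "b - t *\<^sub>R (b - a) \<in> M"
      using convexD_alt[OF M(1-3), of t] convexD_alt[OF M(1-3), of "1 - t"] t
      by (auto simp: algebra_simps)
    have "dist a (a + t *\<^sub>R (b - a)) = t * D" "dist b (b - t *\<^sub>R (b - a)) = t * D"
      using t by (auto simp: dist_norm D_def norm_minus_commute)
    then show ?thesis
      using lip_norm_abs_bound[OF F M(2) in_M(1)] lip_norm_abs_bound[OF F M(3) in_M(2)] inner[OF t]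
      by (simp add: c_def algebra_simps)
  qed
  have "\<bar>F a - F b\<bar> \<le> 0 + \<epsilon>" if "\<epsilon> > 0" for \<epsilon>
  proof -
    define t where "t = min (1 / 4) (\<epsilon> / (c + 1))"
    have t: "0 < t" "t < 1 / 2" using that c by (auto simp: t_def)
    have "t * c \<le> \<epsilon> / (c + 1) * c" using c by (intro mult_right_mono) (auto simp: t_def)
    also have "\<dots> \<le> \<epsilon>" using c that by (simp add: field_simps)
    finally show ?thesis using est[OF t] by simp
  qed
  then have "\<bar>F a - F b\<bar> \<le> 0" by (rule field_le_epsilon)
  then show ?thesis by simp
qed

end

section \<open>Uniqueness\<close>

context lip_predual
begin

text \<open>Each point is compared with \<open>p\<close>, where \<open>F\<close> vanishes; the case
  depends on whether \<open>M\<close> lies in the line through both.\<close>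

lemma small_sequence_limit_zero:
  assumes "convex M" "small_sequence f" "weak_tendsto f F G" "G \<noteq> bot" "G \<le> sequentially"
  shows "F = 0"
proof
  have F: "F \<in> Lip0 M p" using assms(3) by (simp add: weak_tendsto_def)
  fix x
  have "F p = F x" if x: "x \<in> M" "p \<noteq> x"
  proof (cases "\<forall>w\<in>M. \<exists>s. w = p + s *\<^sub>R (x - p)")
    case True
    then show ?thesis
      using small_sequence_limit_on_line[OF assms(2-5,1) base_in x] by blast
  next
    case False
    then obtain w where "w \<in> M" "\<And>s. w \<noteq> p + s *\<^sub>R (x - p)" by blast
    then show ?thesis
      using small_sequence_limit_off_line[OF assms(2-5,1) base_in x(1)] by blast
  qed
  then show "F x = 0 x" using Lip0D[OF F] by (cases "x \<in> M"; cases "p = x") auto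
qed

text \<open>A functional at distance more than \<open>\<epsilon>\<close> from the span of the
  evaluations is at least \<open>\<epsilon>\<close> in absolute value on some norm-one function
  vanishing on any given finite net. These functions form a small sequence, whose limit 0
  contradicts that bound.\<close>

lemma predual_subset_lipschitz_free:
  assumes M: "convex M"
    and nets: "\<And>r e. e > 0 \<Longrightarrow> \<exists>T. finite T \<and> T \<subseteq> M \<and> (\<forall>x\<in>M. dist x p \<le> r \<longrightarrow> (\<exists>t\<in>T. dist x t \<le> e))"
  shows "Y \<subseteq> lipschitz_free M p"
proof
  fix \<phi> assume \<phi>: "\<phi> \<in> Y"
  have "\<exists>y\<in>span (point_evaluation M p ` M). \<forall>x\<in>Lip0 M p. \<bar>\<phi> x - y x\<bar> \<le> \<epsilon> * lip_norm M x"
    if \<epsilon>: "\<epsilon> > 0" for \<epsilon>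
  proof (rule ccontr)
    assume no: "\<not> ?thesis"
    have "\<exists>f\<in>Lip0 M p. lip_norm M f \<le> 1 \<and> \<epsilon> \<le> \<bar>\<phi> f\<bar> \<and>
        (\<forall>x\<in>M. dist x p \<le> real n \<longrightarrow> \<bar>f x\<bar> \<le> 1 / (real n + 1))" for n
    proof -
      \<comment> \<open>A function of norm at most 1 that vanishes on this net is at most
        \<open>1 / (n + 1)\<close> on the ball of radius \<open>n\<close>.\<close>
      obtain T where T: "finite T" "T \<subseteq> M"
        "\<And>x. x \<in> M \<Longrightarrow> dist x p \<le> real n \<Longrightarrow> \<exists>t\<in>T. dist x t \<le> 1 / (real n + 1)"
        using nets[of "1 / (real n + 1)" "real n"] by auto
      have D: "point_evaluation M p ` T \<subseteq> dual_space (Lip0 M p) (lip_norm M)"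
        using T(2) base_in point_evaluation_in_dual by blast
      have "\<exists>f\<in>Lip0 M p. (\<forall>\<psi>\<in>point_evaluation M p ` T. \<psi> f = 0) \<and> \<epsilon> * lip_norm M f < \<bar>\<phi> f\<bar>"
      proof (rule ccontr)
        assume "\<not> ?thesis"
        then have "\<exists>y\<in>span (point_evaluation M p ` T). \<forall>x\<in>Lip0 M p. \<bar>\<phi> x - y x\<bar> \<le> \<epsilon> * lip_norm M x"
          using T(1) D \<epsilon> predual_dual[OF \<phi>] by (intro approx_by_span_of_finite) (auto simp: not_less)
        moreover have "span (point_evaluation M p ` T) \<subseteq> span (point_evaluation M p ` M)"
          using T(2) by (intro span_mono image_mono)
        ultimately show False using no by blast
      qed
      then obtain f where f: "f \<in> Lip0 M p" "\<And>t. t \<in> T \<Longrightarrow> f t = 0" "\<epsilon> * lip_norm M f < \<bar>\<phi> f\<bar>"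
        by (auto simp: point_evaluation_def)
      have "lip_norm M f \<noteq> 0"
        using f norm_definite[OF f(1)] dual_spaceD(4)[OF predual_dual[OF \<phi>]] by auto
      then have pos: "lip_norm M f > 0" using norm_nonneg[OF f(1)] by simp
      define k where "k = (1 / lip_norm M f) *\<^sub>R f"
      have k: "k \<in> Lip0 M p" "lip_norm M k \<le> 1" using f(1) pos by (auto simp: k_def norm_scale)
      have "\<epsilon> \<le> \<bar>\<phi> k\<bar>"
        using f pos by (simp add: k_def dual_spaceD[OF predual_dual[OF \<phi>]] abs_mult le_divide_eq)
      moreover have "\<bar>k x\<bar> \<le> 1 / (real n + 1)" if x: "x \<in> M" "dist x p \<le> real n" for x
      proof -
        obtain t where t: "t \<in> T" "dist x t \<le> 1 / (real n + 1)" using T(3)[OF x] by blast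
        have "k t = 0" using f(2)[OF t(1)] by (simp add: k_def)
        then have "\<bar>k x\<bar> \<le> lip_norm M k * dist x t"
          using lip_norm_abs_bound[OF k(1) x(1), of t] t T(2) by auto
        also have "\<dots> \<le> 1 * dist x t" using k(2) by (intro mult_right_mono) auto
        finally show ?thesis using t(2) by simp
      qed
      ultimately show ?thesis using k by blast
    qed
    then obtain f where f: "\<And>n. f n \<in> Lip0 M p" "\<And>n. lip_norm M (f n) \<le> 1" "\<And>n. \<epsilon> \<le> \<bar>\<phi> (f n)\<bar>"
      "\<And>n x. x \<in> M \<Longrightarrow> dist x p \<le> real n \<Longrightarrow> \<bar>f n x\<bar> \<le> 1 / (real n + 1)" by metis
    then have "small_sequence f" by (simp add: small_sequence_def)
    obtain G F where G: "G \<le> sequentially" "G \<noteq> bot" and lim: "weak_tendsto f F G"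
      by (rule bounded_weak_cluster[OF sequentially_bot f(1,2)])
    have "F = 0" by (rule small_sequence_limit_zero[OF M \<open>small_sequence f\<close> lim G(2,1)])
    then have "\<phi> F = 0" using dual_spaceD(4)[OF predual_dual[OF \<phi>]] by simp
    moreover have "((\<lambda>n. \<bar>\<phi> (f n)\<bar>) \<longlongrightarrow> \<bar>\<phi> F\<bar>) G"
      using lim \<phi> by (auto simp: weak_tendsto_def intro!: tendsto_rabs)
    then have "\<epsilon> \<le> \<bar>\<phi> F\<bar>" using f(3) G(2) by (intro tendsto_lowerbound[of _ _ G]) auto
    ultimately show False using \<epsilon> by simp
  qed
  then show "\<phi> \<in> lipschitz_free M p"
    using predual_dual[OF \<phi>] by (simp add: lipschitz_free_def dual_closure_def)
qed

end

section \<open>Finite nets in finite-dimensional spaces\<close>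

lemma compact_span_Int_cball:
  fixes B :: "'a::real_normed_vector set"
  assumes "finite B"
  shows "compact (span B \<inter> cball 0 r)"
  using assms
proof (induction B arbitrary: r rule: finite_induct)
  case empty
  have "finite (span {} \<inter> cball (0::'a) r)" by simp
  then show ?case by (rule finite_imp_compact)
next
  case (insert b B)
  show ?case
  proof (cases "b \<in> span B")
    case True
    then show ?thesis using insert.IH by (simp add: span_redundant)
  next
    case False
    \<comment> \<open>A convergent sequence is bounded, hence stays in one of the compact pieces
      given by the induction hypothesis.\<close>
    have "closed (span B)"
      unfolding closed_sequential_limits
    proof (intro allI impI, elim conjE)
      fix x l assume x: "\<forall>n. x n \<in> span B" "x \<longlonglongrightarrow> l"
      obtain K where K: "\<And>n. norm (x n) \<le> K"
        using convergent_imp_Bseq[of x] x(2) by (auto simp: convergent_def Bseq_def)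
      have "closed (span B \<inter> cball 0 K)" using insert.IH by (rule compact_imp_closed)
      then have "l \<in> span B \<inter> cball 0 K"
        by (rule closed_sequentially[OF _ _ x(2)]) (use x(1) K in auto)
      then show "l \<in> span B" by simp
    qed
    moreover have "span B \<noteq> {}" using span_zero by blast
    ultimately have d: "infdist b (span B) > 0" (is "?d > 0")
      using False by (simp add: infdist_pos_not_in_closed)
    \<comment> \<open>The distance of \<open>b\<close> from the span bounds the coefficient of
      \<open>b\<close>; the ball thus lies in a continuous image of a compact product.\<close>
    have coeff: "\<bar>c\<bar> * ?d \<le> norm (v + c *\<^sub>R b)" if v: "v \<in> span B" for v c
    proof (cases "c = 0")
      case False
      have "- (1 / c) *\<^sub>R v \<in> span B" using v by (rule span_scale)
      then have "?d \<le> dist b (- (1 / c) *\<^sub>R v)" by (rule infdist_le)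
      then have "\<bar>c\<bar> * ?d \<le> \<bar>c\<bar> * norm (b + (1 / c) *\<^sub>R v)"
        by (intro mult_left_mono) (auto simp: dist_norm)
      also have "\<dots> = norm (c *\<^sub>R (b + (1 / c) *\<^sub>R v))" by simp
      also have "c *\<^sub>R (b + (1 / c) *\<^sub>R v) = v + c *\<^sub>R b"
        using False by (simp add: scaleR_add_right)
      finally show ?thesis .
    qed simp
    define C where "C = r / ?d"
    define R where "R = r + C * norm b"
    let ?K = "(\<lambda>(v, c). v + c *\<^sub>R b) ` ((span B \<inter> cball 0 R) \<times> {- C..C})"
    have K: "compact ?K"
      by (intro compact_continuous_image compact_Times insert.IH)
        (auto simp: case_prod_unfold intro!: continuous_intros)
    have eq: "span (insert b B) \<inter> cball 0 r = ?K \<inter> cball 0 r"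
    proof (rule set_eqI, rule iffI)
      fix x assume x: "x \<in> span (insert b B) \<inter> cball 0 r"
      then obtain c where c: "x - c *\<^sub>R b \<in> span B" by (auto simp: span_insert)
      have "\<bar>c\<bar> * ?d \<le> r" using coeff[OF c, of c] x by simp
      then have c_le: "\<bar>c\<bar> \<le> C" using d by (simp add: C_def le_divide_eq)
      then have "\<bar>c\<bar> * norm b \<le> C * norm b" by (intro mult_right_mono) auto
      then have "norm (x - c *\<^sub>R b) \<le> R"
        using norm_triangle_ineq4[of x "c *\<^sub>R b"] x by (simp add: R_def)
      then have "(x - c *\<^sub>R b, c) \<in> (span B \<inter> cball 0 R) \<times> {- C..C}"
        using c c_le by (auto simp: abs_le_iff)
      then show "x \<in> ?K \<inter> cball 0 r" using x by (auto intro!: image_eqI[of _ _ "(x - c *\<^sub>R b, c)"])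
    next
      fix x assume x: "x \<in> ?K \<inter> cball 0 r"
      then obtain v c where "v \<in> span B" "x = v + c *\<^sub>R b" by auto
      then have "x - c *\<^sub>R b \<in> span B" by simp
      then show "x \<in> span (insert b B) \<inter> cball 0 r" using x by (auto simp: span_insert)
    qed
    show ?thesis unfolding eq using K closed_cball by (rule compact_Int_closed)
  qed
qed

text \<open>The centres of a covering of the ball may lie outside \<open>M\<close>, so each small
  ball meeting \<open>M\<close> contributes a point of \<open>M\<close> instead; this doubles the
  radius, hence \<open>e / 2\<close>.\<close>

lemma finite_net_in_finite_dim:
  fixes B M :: "'a::real_normed_vector set"
  assumes "finite B" "span B = UNIV" "e > 0"
  shows "\<exists>T. finite T \<and> T \<subseteq> M \<and> (\<forall>x\<in>M. dist x p \<le> r \<longrightarrow> (\<exists>t\<in>T. dist x t \<le> e))"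
proof -
  have "compact (cball (0::'a) (norm p + r))"
    using compact_span_Int_cball[OF assms(1)] assms(2) by simp
  then have "\<forall>e>0. \<exists>k. finite k \<and> cball (0::'a) (norm p + r) \<subseteq> (\<Union>x\<in>k. ball x e)"
    unfolding compact_eq_totally_bounded by blast
  moreover have "e / 2 > 0" using assms(3) by simp
  ultimately obtain k where k: "finite k" "cball (0::'a) (norm p + r) \<subseteq> (\<Union>x\<in>k. ball x (e / 2))"
    by blast
  define pick where "pick q = (SOME t. t \<in> M \<inter> ball q (e / 2))" for q
  let ?T = "pick ` {q \<in> k. M \<inter> ball q (e / 2) \<noteq> {}}"
  have pick: "pick q \<in> M \<inter> ball q (e / 2)" if "M \<inter> ball q (e / 2) \<noteq> {}" for q
    unfolding pick_def some_in_eq by (rule that)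
  have "\<exists>t\<in>?T. dist x t \<le> e" if x: "x \<in> M" "dist x p \<le> r" for x
  proof -
    have "norm x \<le> norm p + r" using x(2) norm_triangle_ineq2[of x p] by (simp add: dist_norm)
    then have "x \<in> (\<Union>x\<in>k. ball x (e / 2))" using k(2) by (auto simp: subset_iff)
    then obtain q where q: "q \<in> k" "dist q x < e / 2" by auto
    then have ne: "M \<inter> ball q (e / 2) \<noteq> {}" using x by auto
    have "dist x (pick q) \<le> e"
      using pick[OF ne] q(2) dist_triangle[of x "pick q" q] by (simp add: dist_commute)
    then show ?thesis using q(1) ne by blast
  qed
  moreover have "finite ?T" "?T \<subseteq> M" using k(1) pick by auto
  ultimately show ?thesis by blast
qed

theorem theorem2:
  fixes M :: "'a::banach set" and p :: 'a
  assumes "\<exists>B :: 'a set. finite B \<and> span B = UNIV"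
    and "convex M"
    and "p \<in> M"
  shows "has_strongly_unique_predual (Lip0 M p) (lip_norm M)"
proof -
  obtain B :: "'a set" where B: "finite B" "span B = UNIV" using assms(1) by blast
  have predual: "predual (Lip0 M p) (lip_norm M) Y" if "is_predual (Lip0 M p) (lip_norm M) Y" for Y
    using normed_carrier_Lip0[OF assms(3)] that by (simp add: predual_def predual_axioms_def)
  have free: "is_predual (Lip0 M p) (lip_norm M) (lipschitz_free M p)"
    by (rule is_predual_lipschitz_free[OF assms(3)])
  have "Y = lipschitz_free M p" if Y: "is_predual (Lip0 M p) (lip_norm M) Y" for Y
  \<comment> \<open>Preduals comparable by inclusion coincide, so one inclusion into the free space
    is enough.\<close>
  proof (rule preduals_eq_if_subset[OF predual[OF Y] predual[OF free]])
    interpret lip_predual M p Y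
      using predual[OF Y] assms(3) by (simp add: lip_predual_def lip_predual_axioms_def)
    show "Y \<subseteq> lipschitz_free M p"
      by (rule predual_subset_lipschitz_free[OF assms(2)], rule finite_net_in_finite_dim[OF B])
  qed
  then show ?thesis unfolding has_strongly_unique_predual_def using free by blast
qed

end
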